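(* Let $n\ge3$, let $q$ be a prime power and $\mathbb{V}_0=\mathbb{F}_q^n$. Then for every $\varphi\in Aut(\mathbf{SIG}(\mathbb{V}_0))$ there exists a semilinear automorphism $T:\mathbb{F}_q^n\to\mathbb{F}_q^n$ such that $\varphi(\langle v\rangle)=\langle T(v)\rangle$ for every $\langle v\rangle\in\mathbb{P}^{n-1}(\mathbb{F}_q)$. Equivalently, there exist $A\in GL_n(\mathbb{F}_q)$ and $\sigma\in Aut(\mathbb{F}_q)$ such that $\varphi(\langle v\rangle)=\langle Av^\sigma\rangle$ for every $\langle v\rangle\in\mathbb{P}^{n-1}(\mathbb{F}_q)$. Thus the restriction of $\varphi$ to $\mathbb{P}^{n-1}(\mathbb{F}_q)$ is an element of $P\Gamma L_n(q)=PGL_n(\mathbb{F}_q)\rtimes Aut(\mathbb{F}_q)$. Moreover, the restriction map $\Phi:Aut(\mathbf{SIG}(\mathbb{V}_0))\to P\Gamma L_n(q)$, $\Phi(\varphi)=\varphi|_{\mathbb{P}^{n-1}(\mathbb{F}_q)}$, is a group epimorphism.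
   Context: $\mathbb{F}_q$ is the finite field with $q$ elements and $\mathbb{V}_0=\mathbb{F}_q^n$ is the space of column vectors. $E_n(\mathbb{F}_q)$ is the set of nonzero matrices $M\in M_n(\mathbb{F}_q)$ having at least one eigenvector in $\mathbb{V}_0$ (a nonzero $v$ with $Mv=\lambda v$ for some $\lambda\in\mathbb{F}_q$; $\lambda=0$ allowed). $\mathcal{E}^{n-1}(\mathbb{F}_q)=\{\langle M\rangle: M\in E_n(\mathbb{F}_q)\}$ is the set of one-dimensional subspaces of $M_n(\mathbb{F}_q)$ generated by elements of $E_n(\mathbb{F}_q)$, and $\mathbb{P}^{n-1}(\mathbb{F}_q)$ is the set of one-dimensional subspaces $\langle v\rangle$ of $\mathbb{V}_0$. The spectral incidence graph $\mathbf{SIG}(\mathbb{V}_0)$ is the simple bipartite graph with vertex set the disjoint union $\mathcal{E}^{n-1}(\mathbb{F}_q)\cup\mathbb{P}^{n-1}(\mathbb{F}_q)$ in which $\langle M\rangle$ and $\langle v\rangle$ are adjacent iff $v$ is an eigenvector of $M$. $Aut$ of a graph is its group of graph automorphisms (permutations of the whole vertex set preserving adjacency in both directions). A semilinear automorphism of $\mathbb{F}_q^n$ is a bijection $T$ for which there is a field automorphism $\sigma$ of $\mathbb{F}_q$ with $T(u+v)=T(u)+T(v)$ and $T(\lambda v)=\sigma(\lambda)T(v)$. $v^\sigma$, $B^\sigma$ denote entrywise application of $\sigma$; $Aut(\mathbb{F}_q)$ is the group of field automorphisms. $PGL_n(\mathbb{F}_q)=GL_n(\mathbb{F}_q)/\{\lambda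 I_n:\lambda\ne0\}$. Elements of $P\Gamma L_n(q)$ are pairs $[A,\sigma]$ with product $[A,\sigma][B,\tau]=[AB^\sigma,\sigma\tau]$; this group is identified with the group of permutations $\langle v\rangle\mapsto\langle Av^\sigma\rangle$ of $\mathbb{P}^{n-1}(\mathbb{F}_q)$. *)

theory Defs
  imports "HOL-Analysis.Analysis" "HOL-Algebra.Bij" "HOL-Algebra.Coset"
begin

text \<open>
  The field with \<open>q\<close> elements is an arbitrary type \<open>'a :: {field, finite}\<close> (so \<open>q = CARD('a)\<close>), and
  the space of column vectors of length \<open>n = CARD('n)\<close> over it is \<open>'a ^ 'n\<close>.
\<close>

section \<open>Automorphism groups of simple graphs\<close>

text \<open>A simple graph is a vertex set \<open>V\<close> with a set \<open>E\<close> of two-element subsets of \<open>V\<close>.\<close>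

definition graph_aut :: "'v set \<Rightarrow> 'v set set \<Rightarrow> ('v \<Rightarrow> 'v) set" where
  "graph_aut V E = {f \<in> Bij V. \<forall>u\<in>V. \<forall>w\<in>V. {u, w} \<in> E \<longleftrightarrow> {f u, f w} \<in> E}"

definition graph_Aut :: "'v set \<Rightarrow> 'v set set \<Rightarrow> ('v \<Rightarrow> 'v) monoid" where
  "graph_Aut V E = (BijGroup V)\<lparr>carrier := graph_aut V E\<rparr>"


section \<open>The spectral incidence graph\<close>

definition eigenvec :: "'a::field ^ 'n ^ 'n \<Rightarrow> 'a ^ 'n \<Rightarrow> bool" where
  "eigenvec M v \<longleftrightarrow> v \<noteq> 0 \<and> (\<exists>c. M *v v = c *s v)"

definition mats_with_eigenvec :: "('a::field ^ 'n ^ 'n) set" where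
  "mats_with_eigenvec = {M. M \<noteq> 0 \<and> (\<exists>v. eigenvec M v)}"

text \<open>On matrices, \<open>*s\<close> would multiply each row by an element of \<open>'a ^ 'n\<close>,
  so scaling by an element of \<open>'a\<close> needs its own operation.\<close>

definition mat_scale :: "'a::field \<Rightarrow> 'a ^ 'n ^ 'm \<Rightarrow> 'a ^ 'n ^ 'm" where
  "mat_scale c M = (\<chi> i j. c * M $ i $ j)"

global_interpretation matvs: vector_space "mat_scale :: 'a::field \<Rightarrow> 'a ^ 'n ^ 'm \<Rightarrow> 'a ^ 'n ^ 'm"
  defines mat_span = matvs.span
  by unfold_locales (simp_all add: mat_scale_def vec_eq_iff algebra_simps)

definition mat_points :: "('a::field ^ 'n ^ 'n) set set" where
  "mat_points = {mat_span {M} | M. M \<in> mats_with_eigenvec}"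

definition proj_points :: "('a::field ^ 'n) set set" where
  "proj_points = {vec.span {v} | v. v \<noteq> 0}"

type_synonym ('a, 'n) sig_vertex = "('a ^ 'n ^ 'n) set + ('a ^ 'n) set"

definition SIG_verts :: "('a::field, 'n::finite) sig_vertex set" where
  "SIG_verts = mat_points <+> proj_points"

definition SIG_edges :: "('a::field, 'n::finite) sig_vertex set set" where
  "SIG_edges = {{Inl (mat_span {M}), Inr (vec.span {v})} | M v.
      M \<in> mats_with_eigenvec \<and> eigenvec M v}"

abbreviation SIG_Aut :: "(('a::field, 'n::finite) sig_vertex \<Rightarrow> ('a, 'n) sig_vertex) monoid" where
  "SIG_Aut \<equiv> graph_Aut SIG_verts SIG_edges"

text \<open>The value is a genuine restriction when \<open>\<phi>\<close> maps the right summand into itself.\<close>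

definition restrict_points ::
    "(('a::field, 'n::finite) sig_vertex \<Rightarrow> ('a, 'n) sig_vertex) \<Rightarrow> ('a ^ 'n) set \<Rightarrow> ('a ^ 'n) set" where
  "restrict_points \<phi> = (\<lambda>p\<in>proj_points. projr (\<phi> (Inr p)))"


section \<open>Field automorphisms and semilinear maps\<close>

definition field_aut :: "('a::field \<Rightarrow> 'a) set" where
  "field_aut = {\<sigma>. bij \<sigma> \<and> (\<forall>x y. \<sigma> (x + y) = \<sigma> x + \<sigma> y) \<and> (\<forall>x y. \<sigma> (x * y) = \<sigma> x * \<sigma> y)}"

definition field_Aut :: "('a::field \<Rightarrow> 'a) monoid" where
  "field_Aut = \<lparr>carrier = field_aut, mult = (\<circ>), one = id\<rparr>"

definition semilinear_aut :: "('a::field ^ 'n \<Rightarrow> 'a ^ 'n) \<Rightarrow> bool" where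
  "semilinear_aut T \<longleftrightarrow> bij T \<and> (\<exists>\<sigma>\<in>field_aut.
      (\<forall>u v. T (u + v) = T u + T v) \<and> (\<forall>c v. T (c *s v) = \<sigma> c *s T v))"

definition map_vec :: "('a \<Rightarrow> 'b) \<Rightarrow> 'a ^ 'n \<Rightarrow> 'b ^ 'n" where
  "map_vec f v = (\<chi> i. f (v $ i))"


section \<open>The projective semilinear group\<close>

definition GLn :: "('a::field ^ 'n ^ 'n) monoid" where
  "GLn = \<lparr>carrier = {A. invertible A}, mult = (**), one = mat 1\<rparr>"

definition scalar_mats :: "('a::field ^ 'n ^ 'n) set" where
  "scalar_mats = {mat c | c. c \<noteq> 0}"

definition PGLn :: "('a::field ^ 'n ^ 'n) set monoid" where
  "PGLn = GLn Mod scalar_mats"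

definition semidirect_product ::
    "('g, 'r) monoid_scheme \<Rightarrow> ('h, 's) monoid_scheme \<Rightarrow> ('h \<Rightarrow> 'g \<Rightarrow> 'g) \<Rightarrow> ('g \<times> 'h) monoid" where
  "semidirect_product N H act =
    \<lparr>carrier = carrier N \<times> carrier H,
     mult = \<lambda>(x, h) (y, k). (x \<otimes>\<^bsub>N\<^esub> act h y, h \<otimes>\<^bsub>H\<^esub> k),
     one = (\<one>\<^bsub>N\<^esub>, \<one>\<^bsub>H\<^esub>)\<rparr>"

text \<open>An element of \<open>PGLn\<close> is a coset of the scalar matrices,
  on which a field automorphism acts by the image of the entrywise map.\<close>

definition PGammaL :: "(('a::field ^ 'n ^ 'n) set \<times> ('a \<Rightarrow> 'a)) monoid" where
  "PGammaL = semidirect_product PGLn field_Aut (\<lambda>\<sigma> X. map_matrix \<sigma> ` X)"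

text \<open>The permutation of the projective points induced by an element of \<open>PGammaL\<close>. The vectors
  \<open>A *v map_vec \<sigma> v\<close> for \<open>A\<close> in the coset \<open>X\<close> and \<open>v\<close> in the line \<open>p\<close> are all proportional, so
  taking the span of all of them avoids a choice of representatives (see \<open>PGammaL_perm_apply\<close>).\<close>

definition PGammaL_perm ::
    "('a::field ^ 'n ^ 'n) set \<times> ('a \<Rightarrow> 'a) \<Rightarrow> ('a ^ 'n) set \<Rightarrow> ('a ^ 'n) set" where
  "PGammaL_perm = (\<lambda>(X, \<sigma>). \<lambda>p\<in>proj_points. vec.span {A *v map_vec \<sigma> v | A v. A \<in> X \<and> v \<in> p})"

text \<open>\<open>PGammaL\<close> viewed as a group of permutations of the projective points.\<close>

definition PGammaL_perms :: "(('a::field ^ 'n) set \<Rightarrow> ('a ^ 'n) set) monoid" where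
  "PGammaL_perms = (BijGroup proj_points)\<lparr>carrier := PGammaL_perm ` carrier PGammaL\<rparr>"

lemma PGammaL_perm_apply:
  fixes A :: "'a::field ^ 'n ^ 'n"
  assumes \<sigma>: "\<sigma> \<in> field_aut" and v: "v \<noteq> 0"
  shows "PGammaL_perm (scalar_mats #>\<^bsub>GLn\<^esub> A, \<sigma>) (vec.span {v}) = vec.span {A *v map_vec \<sigma> v}"
proof -
  let ?S = "{B *v map_vec \<sigma> w | B w. B \<in> scalar_mats #>\<^bsub>GLn\<^esub> A \<and> w \<in> vec.span {v}}"
  have p: "vec.span {v} \<in> proj_points"
    using v by (auto simp: proj_points_def)
  have coset: "scalar_mats #>\<^bsub>GLn\<^esub> A = {mat c ** A | c. c \<noteq> 0}"
    by (auto simp: r_coset_def GLn_def scalar_mats_def)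
  have mat: "mat c *v w = c *s w" for c :: 'a and w :: "'a ^ 'n"
    by (simp add: vec_eq_iff matrix_vector_mult_def mat_def if_distrib if_distribR cong: if_cong)
  have mult: "\<sigma> (x * y) = \<sigma> x * \<sigma> y" for x y
    using \<sigma> by (simp add: field_aut_def)
  have "?S \<subseteq> vec.span {A *v map_vec \<sigma> v}"
  proof
    fix x assume "x \<in> ?S"
    then obtain c d where "x = (mat c ** A) *v map_vec \<sigma> (d *s v)"
      unfolding coset vec.span_singleton by blast
    moreover have "map_vec \<sigma> (d *s v) = \<sigma> d *s map_vec \<sigma> v"
      by (simp add: map_vec_def vec_eq_iff mult)
    ultimately have "x = (c * \<sigma> d) *s (A *v map_vec \<sigma> v)"
      by (simp add: matrix_vector_mul_assoc [symmetric] mat vec.scale)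
    then show "x \<in> vec.span {A *v map_vec \<sigma> v}"
      by (auto simp: vec.span_singleton)
  qed
  moreover have "A *v map_vec \<sigma> v \<in> ?S"
  proof -
    have "A \<in> scalar_mats #>\<^bsub>GLn\<^esub> A"
      unfolding coset by (auto intro!: exI [of _ 1])
    then show ?thesis
      using vec.span_base [of v "{v}"] by blast
  qed
  ultimately have "vec.span ?S = vec.span {A *v map_vec \<sigma> v}"
    by (intro vec.span_eq [THEN iffD2]) (auto intro: vec.span_base)
  then show ?thesis
    using p by (simp add: PGammaL_perm_def)
qed

end

theory Submission
  imports Defs
begin

text \<open>
  The graph sees collinearity of points. The matrices that have given vectors as eigenvectors, together
  with the zero matrix, form a subspace, and the number of common neighbours of the corresponding
  points tells the size of this subspace (\<open>card_common_eigen_mats_nbrs\<close>). For three independent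
  vectors its dimension is \<open>3 + n (n - 3)\<close>: three eigenvalues, and arbitrary values on the remaining
  basis vectors. For three pairwise independent vectors in a plane it is at least \<open>1 + n (n - 2)\<close>,
  since the plane may be an eigenspace. For \<open>n \<ge> 3\<close> the second number is larger
  (\<open>indep3_iff_card_common_eigen_mats\<close>). A graph automorphism preserves numbers of common neighbours.
  It also maps points to points, because the identity matrix is adjacent to all points and no point is
  adjacent to all matrices (\<open>SIG_aut_point\<close>). So it acts on the points as a collineation, and
  the fundamental theorem of projective geometry yields a semilinear map
  (\<open>fundamental_theorem_projective_geometry\<close>, \<open>SIG_aut_semilinear\<close>).

  Conversely, a semilinear automorphism \<open>T\<close> acts on the points, and on the matrices by conjugation, and
  preserves the relation of being an eigenvector (\<open>SIG_aut_lift\<close>). Hence the restrictions of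
  the graph automorphisms are exactly the permutations induced by semilinear automorphisms
  (\<open>restrict_points_image\<close>). In matrix form these are the permutations induced by the pairs
  \<open>[A, \<sigma>]\<close>; such a pair is determined by its permutation, which is tested on the basis vectors
  \<open>e\<^sub>i\<close> and on the vectors \<open>e\<^sub>i + r e\<^sub>j\<close> (\<open>PGammaL_perm_inj\<close>).
\<close>

section \<open>Independence of two and three vectors\<close>

lemma span_singleton_eq_iff:
  fixes u v :: "'a::field ^ 'n"
  shows "vec.span {u} = vec.span {v} \<longleftrightarrow> (\<exists>c. c \<noteq> 0 \<and> v = c *s u)"
proof
  assume eq: "vec.span {u} = vec.span {v}"
  then obtain c d where c: "v = c *s u" and d: "u = d *s v"
    using vec.span_base [of u "{u}"] vec.span_base [of v "{v}"]
    unfolding vec.span_singleton by blast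
  show "\<exists>c. c \<noteq> 0 \<and> v = c *s u"
  proof (cases "c = 0")
    case True
    then show ?thesis using c d by (intro exI [of _ 1]) auto
  qed (use c in blast)
next
  assume "\<exists>c. c \<noteq> 0 \<and> v = c *s u"
  then obtain c where c: "c \<noteq> 0" "v = c *s u" by blast
  then have "u = inverse c *s v" by (simp add: vector_smult_assoc)
  then have "u \<in> vec.span {v}" by (metis singletonI vec.span_base vec.span_scale)
  then show "vec.span {u} = vec.span {v}"
    using c unfolding vec.span_eq by (simp add: vec.span_base vec.span_scale)
qed

text \<open>
  Linear independence of two and of three vectors is spelled out with coefficients: in the set
  \<open>{u, v}\<close> a repetition \<open>u = v\<close> is invisible, and the coefficients are what the
  arguments below compare.
\<close>

definition indep2 :: "'a::field ^ 'n \<Rightarrow> 'a ^ 'n \<Rightarrow> bool" where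
  "indep2 u v \<longleftrightarrow> (\<forall>c d. c *s u + d *s v = 0 \<longrightarrow> c = 0 \<and> d = 0)"

definition indep3 :: "'a::field ^ 'n \<Rightarrow> 'a ^ 'n \<Rightarrow> 'a ^ 'n \<Rightarrow> bool" where
  "indep3 u v w \<longleftrightarrow> (\<forall>c d e. c *s u + d *s v + e *s w = 0 \<longrightarrow> c = 0 \<and> d = 0 \<and> e = 0)"

lemmas vec_algebra = vector_add_ldistrib vector_sadd_rdistrib vector_smult_assoc
  vector_ssub_ldistrib vector_sub_rdistrib algebra_simps

lemma indep2D: "indep2 u v \<Longrightarrow> c *s u + d *s v = 0 \<Longrightarrow> c = 0 \<and> d = 0"
  by (simp add: indep2_def)

lemma indep3D: "indep3 u v w \<Longrightarrow> c *s u + d *s v + e *s w = 0 \<Longrightarrow> c = 0 \<and> d = 0 \<and> e = 0"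
  by (simp add: indep3_def)

lemma indep2_iff_span:
  assumes "u \<noteq> 0" "v \<noteq> 0"
  shows "indep2 u v \<longleftrightarrow> vec.span {u} \<noteq> vec.span {v}"
proof
  assume i: "indep2 u v"
  show "vec.span {u} \<noteq> vec.span {v}"
  proof
    assume "vec.span {u} = vec.span {v}"
    then obtain c where "v = c *s u" by (auto simp: span_singleton_eq_iff)
    then have "c *s u + (-1) *s v = 0" by simp
    then show False using i unfolding indep2_def by fastforce
  qed
next
  assume ne: "vec.span {u} \<noteq> vec.span {v}"
  show "indep2 u v"
    unfolding indep2_def
  proof (intro allI impI)
    fix c d assume e: "c *s u + d *s v = 0"
    show "c = 0 \<and> d = 0"
    proof (cases "d = 0")
      case True then show ?thesis using e assms by auto
    next
      case False
      then have c: "c \<noteq> 0" using e assms by auto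
      have "v = inverse d *s (d *s v)" using False by (simp add: vector_smult_assoc)
      also have "d *s v = (-c) *s u" using e by (simp add: eq_neg_iff_add_eq_0 add.commute vec_algebra)
      finally have "v = (- (inverse d * c)) *s u" by (simp add: vec_algebra)
      moreover have "- (inverse d * c) \<noteq> 0" using c False by simp
      ultimately have False using ne span_singleton_eq_iff by blast
      then show ?thesis ..
    qed
  qed
qed

lemma indep2_commute: "indep2 u v \<longleftrightarrow> indep2 v u"
  unfolding indep2_def by (metis add.commute)

lemma indep2_nonzero:
  assumes "indep2 u v" shows "u \<noteq> 0" "v \<noteq> 0"
proof -
  show "u \<noteq> 0" using assms unfolding indep2_def by (metis add.right_neutral vec.scale_zero_left vec.scale_zero_right zero_neq_one)
  show "v \<noteq> 0" using assms unfolding indep2_def by (metis add.left_neutral vec.scale_zero_left vec.scale_zero_right zero_neq_one)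
qed

lemma indep2_coeffs_eq:
  assumes "indep2 u v" "a *s u + b *s v = c *s u + d *s v"
  shows "a = c" "b = d"
proof -
  have "(a - c) *s u + (b - d) *s v = 0"
    using assms(2) by (simp add: vec_algebra)
  then show "a = c" "b = d"
    using assms(1) unfolding indep2_def by fastforce+
qed

lemma indep3_coeffs_eq:
  assumes "indep3 u v w" "a *s u + b *s v + c *s w = a' *s u + b' *s v + c' *s w"
  shows "a = a'" "b = b'" "c = c'"
proof -
  have "(a - a') *s u + (b - b') *s v + (c - c') *s w = 0"
    using assms(2) by (simp add: vec_algebra)
  then have "a - a' = 0 \<and> b - b' = 0 \<and> c - c' = 0"
    using assms(1) unfolding indep3_def by blast
  then show "a = a'" "b = b'" "c = c'" by auto
qed

lemma indep3_scale:
  assumes i: "indep3 u v w" and nz: "a \<noteq> 0" "b \<noteq> 0" "c \<noteq> 0"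
  shows "indep3 (a *s u) (b *s v) (c *s w)"
  unfolding indep3_def
proof (intro allI impI)
  fix d e f assume "d *s (a *s u) + e *s (b *s v) + f *s (c *s w) = 0"
  then have "(d * a) *s u + (e * b) *s v + (f * c) *s w = 0" by (simp add: vector_smult_assoc)
  then have "d * a = 0 \<and> e * b = 0 \<and> f * c = 0" using i unfolding indep3_def by blast
  then show "d = 0 \<and> e = 0 \<and> f = 0" using nz by simp
qed

lemma indep2_scale:
  assumes i: "indep2 u v" and nz: "a \<noteq> 0" "b \<noteq> 0"
  shows "indep2 (a *s u) (b *s v)"
  unfolding indep2_def
proof (intro allI impI)
  fix d e assume "d *s (a *s u) + e *s (b *s v) = 0"
  then have "(d * a) *s u + (e * b) *s v = 0" by (simp add: vector_smult_assoc)
  then have "d * a = 0 \<and> e * b = 0" using i unfolding indep2_def by blast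
  then show "d = 0 \<and> e = 0" using nz by simp
qed

lemma span_pair: "vec.span {u, v} = {c *s u + d *s v | c d. True}" for u v :: "'a::field ^ 'n"
proof -
  have "x \<in> vec.span {u, v} \<longleftrightarrow> (\<exists>c d. x - c *s u = d *s v)" for x
    unfolding vec.span_breakdown_eq vec.span_singleton vec.span_empty by blast
  then have "x \<in> vec.span {u, v} \<longleftrightarrow> (\<exists>c d. x = c *s u + d *s v)" for x
    by (simp add: diff_eq_eq add.commute)
  then show ?thesis by auto
qed

section \<open>The fundamental theorem of projective geometry\<close>

text \<open>
  The map \<open>g\<close> gives representatives of the image points of a map of projective points.
  The plan is to rescale these representatives until they become additive.

  Let \<open>a\<close> be a basis vector, \<open>H\<close> the complementary coordinate hyperplane and \<open>w = g a\<close>. For a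
  nonzero \<open>x \<in> H\<close> the point of \<open>a + x\<close> lies on the line through the points of \<open>a\<close> and \<open>x\<close> and
  differs from both, so the image of \<open>x\<close> has exactly one representative \<open>h x\<close> for which \<open>w + h x\<close>
  represents the image of \<open>a + x\<close>. For independent \<open>x, y \<in> H\<close> the point of \<open>a + x + y\<close> is the
  intersection of two lines, and so is the point of \<open>x + y\<close>; carrying this over to the images gives
  \<open>h (x + y) = h x + h y\<close>. A third vector, independent of \<open>x\<close>, reduces the case of dependent
  \<open>x, y\<close> to this one, and this is where dimension at least three enters.

  Since \<open>h\<close> is additive, the factor \<open>\<sigma> t\<close> in \<open>h (t *s x) = \<sigma> t *s h x\<close> does not depend on \<open>x\<close>, and
  \<open>\<sigma>\<close> is additive and multiplicative. The semilinear map is \<open>t *s a + x \<mapsto> \<sigma> t *s w + h x\<close>.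
\<close>

theorem fundamental_theorem_projective_geometry:
  fixes g :: "'a::field ^ 'n \<Rightarrow> 'b::field ^ 'm"
  assumes card: "CARD('n) \<ge> 3"
    and nonzero: "\<And>v. v \<noteq> 0 \<Longrightarrow> g v \<noteq> 0"
    and scale: "\<And>c v. c \<noteq> 0 \<Longrightarrow> v \<noteq> 0 \<Longrightarrow> vec.span {g (c *s v)} = vec.span {g v}"
    and line: "\<And>u v c d. indep2 u v \<Longrightarrow> c *s u + d *s v \<noteq> 0 \<Longrightarrow> g (c *s u + d *s v) \<in> vec.span {g u, g v}"
    and indep2: "\<And>u v. indep2 u v \<Longrightarrow> indep2 (g u) (g v)"
    and indep3: "\<And>u v w. indep3 u v w \<Longrightarrow> indep3 (g u) (g v) (g w)"
  obtains T \<sigma> where "\<sigma> 1 = 1" "\<And>c d. \<sigma> (c + d) = \<sigma> c + \<sigma> d" "\<And>c d. \<sigma> (c * d) = \<sigma> c * \<sigma> d"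
    "\<And>u v. T (u + v) = T u + T v" "\<And>c v. T (c *s v) = \<sigma> c *s T v"
    "\<And>v. v \<noteq> 0 \<Longrightarrow> vec.span {T v} = vec.span {g v}"
proof -
  obtain i j k :: 'n where ijk: "i \<noteq> j" "i \<noteq> k" "j \<noteq> k"
  proof -
    obtain S :: "'n set" where "card S = 3" using card obtain_subset_with_card_n by blast
    then show thesis using that by (auto simp: card_3_iff)
  qed
  define a :: "'a ^ 'n" where "a = axis i 1"
  define H :: "('a ^ 'n) set" where "H = {x. x $ i = 0}"
  have a_i: "a $ i = 1" by (simp add: a_def axis_def)
  have a_indep2: "indep2 a x" if "x \<in> H" "x \<noteq> 0" for x
    unfolding indep2_def
  proof (intro allI impI)
    fix c d assume e: "c *s a + d *s x = 0"
    then have "(c *s a + d *s x) $ i = 0" by simp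
    then have "c = 0" using that a_i by (simp add: H_def)
    then show "c = 0 \<and> d = 0" using e that by auto
  qed
  have a_indep3: "indep3 a x y" if "x \<in> H" "y \<in> H" "indep2 x y" for x y
    unfolding indep3_def
  proof (intro allI impI)
    fix c d f assume e: "c *s a + d *s x + f *s y = 0"
    then have "(c *s a + d *s x + f *s y) $ i = 0" by simp
    then have "c = 0" using that a_i by (simp add: H_def)
    then show "c = 0 \<and> d = 0 \<and> f = 0" using e that by (auto simp: indep2_def)
  qed
  have H_add: "x + y \<in> H" and H_scale: "c *s x \<in> H" if "x \<in> H" "y \<in> H" for x y c
    using that by (auto simp: H_def)
  define w where "w = g a"
  have ex: "\<exists>y. vec.span {y} = vec.span {g x} \<and> vec.span {w + y} = vec.span {g (a + x)}"
    if x: "x \<in> H" "x \<noteq> 0" for x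
  proof -
    note ax = a_indep2 [OF x]
    have ax1: "indep2 (a + x) x" "indep2 (a + x) a"
    proof -
      show "indep2 (a + x) x" unfolding indep2_def
      proof (intro allI impI)
        fix c d assume "c *s (a + x) + d *s x = 0"
        then have "c *s a + (c + d) *s x = 0" by (simp add: vec_algebra)
        from indep2D [OF ax this] show "c = 0 \<and> d = 0" by auto
      qed
      show "indep2 (a + x) a" unfolding indep2_def
      proof (intro allI impI)
        fix c d assume "c *s (a + x) + d *s a = 0"
        then have "(c + d) *s a + c *s x = 0" by (simp add: vec_algebra)
        from indep2D [OF ax this] show "c = 0 \<and> d = 0" by auto
      qed
    qed
    have "g (1 *s a + 1 *s x) \<in> vec.span {g a, g x}"
      by (rule line [OF ax]) (use ax1 indep2_nonzero in simp)
    then obtain c d where cd: "g (a + x) = c *s w + d *s g x"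
      by (auto simp: span_pair w_def)
    have "c \<noteq> 0"
    proof
      assume "c = 0"
      then have "1 *s g (a + x) + (-d) *s g x = 0" using cd by simp
      from indep2D [OF indep2 [OF ax1(1)] this] show False by simp
    qed
    have "d \<noteq> 0"
    proof
      assume "d = 0"
      then have "1 *s g (a + x) + (-c) *s g a = 0" using cd by (simp add: w_def)
      from indep2D [OF indep2 [OF ax1(2)] this] show False by simp
    qed
    have "g (a + x) = c *s (w + (d / c) *s g x)"
      using cd \<open>c \<noteq> 0\<close> by (simp add: vec_algebra)
    then have "vec.span {w + (d / c) *s g x} = vec.span {g (a + x)}"
      using \<open>c \<noteq> 0\<close> span_singleton_eq_iff by blast
    moreover have "vec.span {(d / c) *s g x} = vec.span {g x}"
      using \<open>c \<noteq> 0\<close> \<open>d \<noteq> 0\<close> span_singleton_eq_iff [of "g x" "(d / c) *s g x"]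
      by (metis divide_eq_0_iff)
    ultimately show ?thesis by blast
  qed
  \<comment> \<open>Setting \<open>h 0 = 0\<close> extends additivity to all of \<open>H\<close>.\<close>
  define h where "h x = (if x = 0 then 0 else
    SOME y. vec.span {y} = vec.span {g x} \<and> vec.span {w + y} = vec.span {g (a + x)})" for x
  have h0: "h 0 = 0" by (simp add: h_def)
  have h: "vec.span {h x} = vec.span {g x}" "vec.span {w + h x} = vec.span {g (a + x)}"
    if "x \<in> H" "x \<noteq> 0" for x
    using someI_ex [OF ex [OF that]] that by (auto simp: h_def)
  have h_multiple: "\<exists>c. c \<noteq> 0 \<and> h x = c *s g x" if "x \<in> H" "x \<noteq> 0" for x
    using h(1) [OF that] span_singleton_eq_iff by metis
  have h_nonzero: "h x \<noteq> 0" if "x \<in> H" "x \<noteq> 0" for x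
    using h_multiple [OF that] nonzero [OF that(2)] by auto
  have w_h_indep2: "indep2 w (h x)" if x: "x \<in> H" "x \<noteq> 0" for x
  proof -
    obtain c where "c \<noteq> 0" "h x = c *s g x" using h_multiple x by blast
    then show ?thesis
      using indep2_scale [OF indep2 [OF a_indep2 [OF x]], of 1 c] by (simp add: w_def)
  qed
  have h_unique: "y = h x"
    if x: "x \<in> H" "x \<noteq> 0" and y: "vec.span {y} = vec.span {g x}" "vec.span {w + y} = vec.span {g (a + x)}"
    for x y
  proof -
    obtain c where c: "y = c *s h x" using y h(1) [OF x] span_singleton_eq_iff by metis
    obtain d where d: "w + y = d *s (w + h x)" using y h(2) [OF x] span_singleton_eq_iff by metis
    have "1 *s w + c *s h x = d *s w + d *s h x" using c d by (simp add: vec_algebra)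
    from indep2_coeffs_eq [OF w_h_indep2 [OF x] this] c show ?thesis by simp
  qed
  have h_indep: "indep2 (h x) (h y)" "indep3 w (h x) (h y)"
    if xy: "x \<in> H" "y \<in> H" "indep2 x y" for x y
  proof -
    have "x \<noteq> 0" "y \<noteq> 0" using indep2_nonzero xy by auto
    then obtain c d where "c \<noteq> 0" "h x = c *s g x" "d \<noteq> 0" "h y = d *s g y"
      using h_multiple xy by metis
    then show "indep2 (h x) (h y)" "indep3 w (h x) (h y)"
      using indep2_scale [OF indep2 [OF xy(3)], of c d]
        indep3_scale [OF indep3 [OF a_indep3 [OF xy]], of 1 c d] by (simp_all add: w_def)
  qed
  have line': "g (u + v) \<in> vec.span {u', v'}"
    if "indep2 u v" "u + v \<noteq> 0" "vec.span {u'} = vec.span {g u}" "vec.span {v'} = vec.span {g v}" for u v u' v'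
  proof -
    have "g u \<in> vec.span {u', v'}" "g v \<in> vec.span {u', v'}"
      using that vec.span_base [of "g u" "{g u}"] vec.span_base [of "g v" "{g v}"]
        vec.span_mono [of "{u'}" "{u', v'}"] vec.span_mono [of "{v'}" "{u', v'}"] by auto
    then have "vec.span {g u, g v} \<subseteq> vec.span {u', v'}"
      by (intro vec.span_minimal) auto
    then show ?thesis using line [OF that(1), of 1 1] that(2) by auto
  qed
  have h_add_indep: "h (x + y) = h x + h y" if xy: "x \<in> H" "y \<in> H" "indep2 x y" for x y
  proof -
    have nz: "x \<noteq> 0" "y \<noteq> 0" using indep2_nonzero xy by auto
    have ind: "indep3 a x y" using a_indep3 xy by blast
    have comb: "indep2 (c1 *s a + c2 *s x + c3 *s y) (d1 *s a + d2 *s x + d3 *s y)"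
      if "\<And>c d. c * c1 + d * d1 = 0 \<Longrightarrow> c * c2 + d * d2 = 0 \<Longrightarrow> c * c3 + d * d3 = 0 \<Longrightarrow> c = 0 \<and> d = 0" for c1 c2 c3 d1 d2 d3
      unfolding indep2_def
    proof (intro allI impI)
      fix c d assume "c *s (c1 *s a + c2 *s x + c3 *s y) + d *s (d1 *s a + d2 *s x + d3 *s y) = 0"
      then have "(c * c1 + d * d1) *s a + (c * c2 + d * d2) *s x + (c * c3 + d * d3) *s y = 0"
        by (simp add: vec_algebra)
      from indep3D [OF ind this] show "c = 0 \<and> d = 0" using that by blast
    qed
    \<comment> \<open>The point of \<open>a + x + y\<close> lies on the lines through \<open>a + x\<close>, \<open>y\<close> and through \<open>a + y\<close>, \<open>x\<close>;
      the point of \<open>x + y\<close> lies on the lines through \<open>x\<close>, \<open>y\<close> and through \<open>a + x + y\<close>, \<open>a\<close>.\<close>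
    have i1: "indep2 (a + x) y" using comb [of 1 0 1 0 0 1] by simp
    have i2: "indep2 (a + y) x" using comb [of 1 0 0 1 1 0] by simp
    have i3: "indep2 (a + x + y) (- a)" using comb [of 1 "-1" 1 0 1 0] by simp
    have xy0: "x + y \<noteq> 0" "x + y \<in> H" using xy(3) unfolding indep2_def
      by (metis vec.scale_one zero_neq_one, use H_add xy in blast)
    have axy0: "a + x + y \<noteq> 0" using indep2_nonzero i3 by blast
    have "g (a + x + y) \<in> vec.span {w + h x, h y}"
      by (rule line' [OF i1 axy0]) (use h xy nz in auto)
    moreover have "g (a + y + x) \<in> vec.span {w + h y, h x}"
      by (rule line' [OF i2]) (use h xy nz axy0 in \<open>auto simp: add_ac\<close>)
    ultimately obtain \<alpha> \<beta> \<gamma> \<delta> where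
      e1: "g (a + x + y) = \<alpha> *s (w + h x) + \<beta> *s h y" and e2: "g (a + x + y) = \<gamma> *s (w + h y) + \<delta> *s h x"
      unfolding span_pair add.assoc add.commute [of y x] by blast
    have "\<alpha> *s w + \<alpha> *s h x + \<beta> *s h y = \<gamma> *s w + \<delta> *s h x + \<gamma> *s h y"
      using e1 e2 by (simp add: vec_algebra)
    from indep3_coeffs_eq [OF h_indep(2) [OF xy] this]
    have e3: "g (a + x + y) = \<alpha> *s (w + (h x + h y))" using e1 by (simp add: vec_algebra)
    then have \<alpha>: "\<alpha> \<noteq> 0" using nonzero axy0 by auto
    have s1: "vec.span {w + (h x + h y)} = vec.span {g (a + (x + y))}"
      unfolding span_singleton_eq_iff using e3 \<alpha> by (auto simp: add.assoc)
    have "a \<noteq> 0" using a_i by auto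
    then have "vec.span {w} = vec.span {g (- a)}"
      using scale [of "-1" a] by (simp add: w_def vector_sneg_minus1 [symmetric])
    then have "g (a + x + y + - a) \<in> vec.span {w + (h x + h y), w}"
      by (intro line' [OF i3]) (use s1 xy0 in \<open>auto simp: add_ac\<close>)
    then obtain c1 c2 where c: "g (x + y) = c1 *s (w + (h x + h y)) + c2 *s w"
      by (auto simp: span_pair)
    have "g (x + y) \<in> vec.span {h x, h y}"
      by (rule line' [OF xy(3)]) (use h xy nz xy0 in auto)
    then obtain d1 d2 where d: "g (x + y) = d1 *s h x + d2 *s h y"
      by (auto simp: span_pair)
    have "(c1 + c2) *s w + c1 *s h x + c1 *s h y = 0 *s w + d1 *s h x + d2 *s h y"
      using c d by (simp add: vec_algebra)
    from indep3_coeffs_eq [OF h_indep(2) [OF xy] this]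
    have d': "g (x + y) = d1 *s (h x + h y)" using d by (simp add: vec_algebra)
    then have "d1 \<noteq> 0" using nonzero xy0 by auto
    then have s2: "vec.span {h x + h y} = vec.span {g (x + y)}" using d' span_singleton_eq_iff by blast
    show ?thesis using h_unique [OF xy0(2,1) s2 s1] by simp
  qed
  define b c where "b = (axis j 1 :: 'a ^ 'n)" and "c = (axis k 1 :: 'a ^ 'n)"
  have bc: "b \<in> H" "c \<in> H" "b \<noteq> 0" using ijk by (auto simp: b_def c_def H_def axis_def vec_eq_iff)
  have third: "\<exists>z\<in>H. indep2 x z" if x: "x \<in> H" "x \<noteq> 0" for x
  proof (rule ccontr)
    assume neg: "\<not> (\<exists>z\<in>H. indep2 x z)"
    have bc2: "indep2 b c"
      unfolding indep2_def
    proof (intro allI impI)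
      fix s t assume e: "s *s b + t *s c = 0"
      then have "(s *s b + t *s c) $ j = 0" "(s *s b + t *s c) $ k = 0" by auto
      then show "s = 0 \<and> t = 0" using ijk by (simp add: b_def c_def axis_def)
    qed
    then have "vec.span {x} = vec.span {b}" "vec.span {x} = vec.span {c}"
      using neg bc x indep2_nonzero [OF bc2] indep2_iff_span by blast+
    then show False using bc2 indep2_nonzero [OF bc2] indep2_iff_span by metis
  qed
  have indep2_add: "indep2 x (y + z)" if xy: "y = m *s x" and xz: "indep2 x z" for x y z :: "'a ^ 'n" and m
    unfolding indep2_def
  proof (intro allI impI)
    fix c d assume "c *s x + d *s (y + z) = 0"
    then have "(c + d * m) *s x + d *s z = 0" using xy by (simp add: vec_algebra)
    from indep2D [OF xz this] show "c = 0 \<and> d = 0" by auto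
  qed
  have h_add: "h (x + y) = h x + h y" if xy: "x \<in> H" "y \<in> H" for x y
  proof -
    consider "x = 0 \<or> y = 0" | "x \<noteq> 0" "y \<noteq> 0" "indep2 x y" | "x \<noteq> 0" "y \<noteq> 0" "vec.span {x} = vec.span {y}"
      using indep2_iff_span by blast
    then show ?thesis
    proof cases
      case 1 then show ?thesis using h0 by auto
    next
      case 2 then show ?thesis using h_add_indep xy by blast
    next
      case 3
      \<comment> \<open>Both sides of \<open>x + (y + z) = (x + y) + z\<close> add independent vectors, except when
        \<open>x + y = 0\<close>.\<close>
      obtain z where z: "z \<in> H" "indep2 x z" using third xy 3 by blast
      obtain m where m: "m \<noteq> 0" "y = m *s x" using 3 span_singleton_eq_iff by metis
      have yz: "indep2 y z" using indep2_scale [OF z(2) m(1), of 1] m by simp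
      have "h x + h y + h z = h x + h (y + z)" using h_add_indep xy z yz by (simp add: add.assoc)
      also have "\<dots> = h (x + (y + z))"
        using h_add_indep [of x "y + z"] indep2_add [OF m(2) z(2)] H_add xy z by simp
      also have "\<dots> = h ((x + y) + z)" by (simp add: add.assoc)
      also have "\<dots> = h (x + y) + h z"
      proof (cases "x + y = 0")
        case True then show ?thesis by (simp add: h0)
      next
        case False
        have xm: "x + y = (1 + m) *s x" using m by (simp add: vec_algebra)
        have "1 + m \<noteq> 0"
        proof
          assume "1 + m = 0"
          then show False using xm False by (metis vec.scale_zero_left)
        qed
        from indep2_scale [OF z(2) this, of 1] xm have "indep2 (x + y) z" by simp
        then show ?thesis using h_add_indep H_add xy z by blast
      qed
      finally show ?thesis by simp
    qed
  qed
  have h_scale_ex: "\<exists>s. h (t *s x) = s *s h x" if "x \<in> H" "x \<noteq> 0" for x t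
  proof (cases "t = 0")
    case True then show ?thesis by (intro exI [of _ 0]) (simp add: h0)
  next
    case False
    have "vec.span {h x} = vec.span {h (t *s x)}"
      using False that H_scale h(1) [of x] h(1) [of "t *s x"] scale [of t x] by simp
    then show ?thesis using span_singleton_eq_iff by metis
  qed
  \<comment> \<open>Comparing \<open>h (t *s (x + y))\<close> with \<open>h (t *s x) + h (t *s y)\<close> shows that independent vectors
    have the same factor.\<close>
  have transfer: "h (t *s y) = s *s h y"
    if xy: "x \<in> H" "y \<in> H" "indep2 x y" and s: "h (t *s x) = s *s h x" for x y s t
  proof -
    note nz = indep2_nonzero [OF xy(3)]
    obtain s' where s': "h (t *s y) = s' *s h y" using h_scale_ex xy nz by blast
    have xy0: "x + y \<noteq> 0" "x + y \<in> H" using xy(3) unfolding indep2_def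
      by (metis vec.scale_one zero_neq_one, use H_add xy in blast)
    obtain r where "h (t *s (x + y)) = r *s h (x + y)" using h_scale_ex xy0 by blast
    then have "s *s h x + s' *s h y = r *s h x + r *s h y"
      using h_add [OF H_scale H_scale, of x x y y t t] h_add [of x y] xy s s' by (simp add: vector_add_ldistrib)
    from indep2_coeffs_eq [OF h_indep(1) [OF xy] this] s' show ?thesis by simp
  qed
  have "\<exists>\<sigma>. \<forall>t. h (t *s b) = \<sigma> t *s h b"
    using h_scale_ex bc by (intro choice) blast
  then obtain \<sigma> where \<sigma>b: "\<And>t. h (t *s b) = \<sigma> t *s h b" by blast
  have h_scale: "h (t *s x) = \<sigma> t *s h x" if x: "x \<in> H" for t x
  proof -
    consider "x = 0" | "x \<noteq> 0" "indep2 b x" | "x \<noteq> 0" "vec.span {b} = vec.span {x}"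
      using indep2_iff_span bc by blast
    then show ?thesis
    proof cases
      case 1 then show ?thesis by (simp add: h0)
    next
      case 2 then show ?thesis using transfer [OF bc(1) x _ \<sigma>b] by blast
    next
      case 3
      obtain z where z: "z \<in> H" "indep2 b z" using third bc by blast
      obtain m where m: "m \<noteq> 0" "x = m *s b" using 3 span_singleton_eq_iff by metis
      have "indep2 z x" using indep2_scale [OF z(2) m(1), of 1] m by (simp add: indep2_commute)
      then show ?thesis using transfer [OF z(1) x _ transfer [OF bc(1) z \<sigma>b]] by blast
    qed
  qed
  have hb: "h b \<noteq> 0" using h_nonzero bc by blast
  have cancel: "r = s" if "r *s h b = s *s h b" for r s using hb that by simp
  have \<sigma>1: "\<sigma> 1 = 1" by (rule cancel) (use \<sigma>b [of 1] in simp)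
  have \<sigma>add: "\<sigma> (s + t) = \<sigma> s + \<sigma> t" for s t
  proof (rule cancel)
    have "\<sigma> (s + t) *s h b = h (s *s b + t *s b)" by (simp only: \<sigma>b [symmetric] vector_sadd_rdistrib)
    also have "\<dots> = h (s *s b) + h (t *s b)" using h_add H_scale bc by blast
    also have "\<dots> = (\<sigma> s + \<sigma> t) *s h b" by (simp only: \<sigma>b vector_sadd_rdistrib)
    finally show "\<sigma> (s + t) *s h b = (\<sigma> s + \<sigma> t) *s h b" .
  qed
  have \<sigma>mult: "\<sigma> (s * t) = \<sigma> s * \<sigma> t" for s t
  proof (rule cancel)
    have "\<sigma> (s * t) *s h b = h (s *s (t *s b))" by (simp only: \<sigma>b [symmetric] vector_smult_assoc)
    also have "\<dots> = \<sigma> s *s h (t *s b)" using h_scale H_scale bc by blast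
    also have "\<dots> = (\<sigma> s * \<sigma> t) *s h b" by (simp only: \<sigma>b vector_smult_assoc)
    finally show "\<sigma> (s * t) *s h b = (\<sigma> s * \<sigma> t) *s h b" .
  qed
  define T where "T v = \<sigma> (v $ i) *s w + h (v - v $ i *s a)" for v
  have inH: "v - v $ i *s a \<in> H" for v by (simp add: H_def a_i)
  have Tadd: "T (u + v) = T u + T v" for u v
  proof -
    have "u + v - (u + v) $ i *s a = (u - u $ i *s a) + (v - v $ i *s a)" by (simp add: vec_algebra)
    then show ?thesis using h_add [OF inH [of u] inH [of v]] by (simp add: T_def \<sigma>add vec_algebra)
  qed
  have Tscale: "T (t *s v) = \<sigma> t *s T v" for t v
  proof -
    have "t *s v - (t *s v) $ i *s a = t *s (v - v $ i *s a)" by (simp add: vec_algebra)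
    then show ?thesis using h_scale [OF inH [of v], of t] by (simp add: T_def \<sigma>mult vec_algebra)
  qed
  have Tg: "vec.span {T v} = vec.span {g v}" if v: "v \<noteq> 0" for v
  proof (cases "v $ i = 0")
    case True
    have "\<sigma> 0 = 0" by (rule add_left_imp_eq [of "\<sigma> 0"]) (simp add: \<sigma>add [symmetric])
    then show ?thesis using True h(1) [of v] v by (simp add: T_def H_def)
  next
    case False
    define t where "t = v $ i"
    define x where "x = inverse t *s v - a"
    have t0: "t \<noteq> 0" using False by (simp add: t_def)
    have x: "x \<in> H" using False by (simp add: x_def H_def a_i t_def)
    have v_eq: "v = t *s (a + x)" using t0 by (simp add: x_def vector_smult_assoc)
    have Ta: "T (a + x) = w + h x" using x by (simp add: T_def a_i H_def \<sigma>1)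
    have "\<sigma> t * \<sigma> (inverse t) = 1" using \<sigma>mult [of t "inverse t"] \<sigma>1 False by (simp add: t_def)
    then have "\<sigma> t \<noteq> 0" by auto
    moreover have "T v = \<sigma> t *s (w + h x)" using Tscale [of t "a + x"] by (simp only: Ta v_eq [symmetric])
    ultimately have "vec.span {w + h x} = vec.span {T v}" using span_singleton_eq_iff by blast
    then have "vec.span {T v} = vec.span {w + h x}" ..
    also have "\<dots> = vec.span {g (a + x)}"
      by (cases "x = 0") (use h(2) x in \<open>auto simp: h0 w_def\<close>)
    also have "\<dots> = vec.span {g v}" 
    proof -
      have "a + x \<noteq> 0" using v v_eq by (metis vec.scale_zero_right)
      then have "vec.span {g (t *s (a + x))} = vec.span {g (a + x)}"
        by (rule scale [OF t0])
      then show ?thesis by (simp only: v_eq [symmetric])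
    qed
    finally show ?thesis .
  qed
  show thesis by (rule that [OF \<sigma>1 \<sigma>add \<sigma>mult Tadd Tscale Tg])
qed

section \<open>Counting matrices with prescribed eigenvectors\<close>

lemma card_span_singleton:
  fixes v :: "'a::{field,finite} ^ 'n"
  assumes "v \<noteq> 0"
  shows "card (vec.span {v}) = CARD('a)"
proof -
  have "inj (\<lambda>c. c *s v)" using assms by (auto simp: inj_on_def)
  then show ?thesis by (simp add: vec.span_singleton card_image)
qed

text \<open>
  A matrix is determined by its values on a basis, and these can be chosen freely.
\<close>

lemma card_matrices_prescribed:
  fixes B :: "('a::{field,finite} ^ 'n) set" and S :: "'a ^ 'n \<Rightarrow> ('a ^ 'n) set"
  assumes B: "vec.independent B" "vec.span B = UNIV"
  shows "card {M :: 'a ^ 'n ^ 'n. \<forall>b\<in>B. M *v b \<in> S b} = (\<Prod>b\<in>B. card (S b))"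
proof -
  let ?r = "\<lambda>M :: 'a ^ 'n ^ 'n. restrict (\<lambda>b. M *v b) B"
  have "bij_betw ?r {M. \<forall>b\<in>B. M *v b \<in> S b} (\<Pi>\<^sub>E b\<in>B. S b)"
    unfolding bij_betw_def
  proof
    show "inj_on ?r {M. \<forall>b\<in>B. M *v b \<in> S b}"
    proof (rule inj_onI)
      fix M N assume eq: "?r M = ?r N"
      have "M *v x = N *v x" for x
      proof (rule vec.linear_eq_on [OF matrix_vector_mul_linear_gen matrix_vector_mul_linear_gen])
        show "x \<in> vec.span B" using B by simp
        show "M *v b = N *v b" if "b \<in> B" for b
          using fun_cong [OF eq, of b] that by simp
      qed
      then show "M = N" by (simp add: matrix_eq)
    qed
    show "?r ` {M. \<forall>b\<in>B. M *v b \<in> S b} = (\<Pi>\<^sub>E b\<in>B. S b)"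
    proof
      show "?r ` {M. \<forall>b\<in>B. M *v b \<in> S b} \<subseteq> (\<Pi>\<^sub>E b\<in>B. S b)" by auto
      show "(\<Pi>\<^sub>E b\<in>B. S b) \<subseteq> ?r ` {M. \<forall>b\<in>B. M *v b \<in> S b}"
      proof
        fix f assume f: "f \<in> (\<Pi>\<^sub>E b\<in>B. S b)"
        obtain l where l: "Vector_Spaces.linear (*s) (*s) l" "\<forall>b\<in>B. l b = f b"
          using vec.linear_independent_extend [OF B(1), of f] by blast
        then have M: "\<forall>b\<in>B. matrix l *v b = f b" by (simp add: matrix_works)
        then have "f = ?r (matrix l)" using f by (auto simp: fun_eq_iff PiE_def extensional_def)
        then show "f \<in> ?r ` {M. \<forall>b\<in>B. M *v b \<in> S b}" using M f by auto
      qed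
    qed
  qed
  then have "card {M :: 'a ^ 'n ^ 'n. \<forall>b\<in>B. M *v b \<in> S b} = card (\<Pi>\<^sub>E b\<in>B. S b)"
    by (rule bij_betw_same_card)
  then show ?thesis by (simp add: card_PiE)
qed

lemma extend_to_basis:
  fixes S :: "('a::{field,finite} ^ 'n) set"
  assumes "vec.independent S"
  obtains B where "S \<subseteq> B" "vec.independent B" "vec.span B = UNIV" "card B = CARD('n)"
proof -
  have "card (vec.extend_basis S) = vec.dim (UNIV :: ('a ^ 'n) set)"
    using vec.span_extend_basis [OF assms] vec.independent_extend_basis [OF assms]
    by (intro vec.basis_card_eq_dim) auto
  then show thesis
    using that vec.extend_basis_superset [OF assms] vec.independent_extend_basis [OF assms]
      vec.span_extend_basis [OF assms] by (simp only: vec_dim_card)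
qed

definition common_eigen_mats :: "('a::field ^ 'n) set \<Rightarrow> ('a ^ 'n ^ 'n) set" where
  "common_eigen_mats S = {M. \<forall>v\<in>S. M *v v \<in> vec.span {v}}"

lemma independent_pair:
  assumes i: "indep2 u v"
  shows "vec.independent {u, v}" "u \<noteq> v"
proof -
  have nz: "u \<noteq> 0" "v \<noteq> 0" using indep2_nonzero i by auto
  have "u \<notin> vec.span {v}"
  proof
    assume "u \<in> vec.span {v}"
    then obtain k where "u = k *s v" by (auto simp: vec.span_singleton)
    then have "1 *s u + (-k) *s v = 0" by simp
    from indep2D [OF i this] show False by simp
  qed
  then show "vec.independent {u, v}" "u \<noteq> v"
    using nz vec.span_base [of v "{v}"] by (auto simp: vec.independent_insert)
qed

lemma indep3_pair:
  assumes "indep3 u v w" shows "indep2 v w"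
  unfolding indep2_def
proof (intro allI impI)
  fix c d assume "c *s v + d *s w = 0"
  then have "0 *s u + c *s v + d *s w = 0" by simp
  from indep3D [OF assms this] show "c = 0 \<and> d = 0" by simp
qed

lemma independent_triple:
  assumes i: "indep3 u v w"
  shows "vec.independent {u, v, w}" "card {u, v, w} = 3"
proof -
  have vw: "vec.independent {v, w}" "v \<noteq> w" using independent_pair indep3_pair [OF i] by auto
  have "u \<notin> vec.span {v, w}"
  proof
    assume "u \<in> vec.span {v, w}"
    then obtain k l where "u = k *s v + l *s w" by (auto simp: span_pair)
    then have "1 *s u + (-k) *s v + (-l) *s w = 0" by simp
    from indep3D [OF i this] show False by simp
  qed
  moreover from this have "u \<noteq> v" "u \<noteq> w"
    using vec.span_base [of v "{v, w}"] vec.span_base [of w "{v, w}"] by auto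
  ultimately show "vec.independent {u, v, w}" "card {u, v, w} = 3"
    using vw by (simp_all add: vec.independent_insert)
qed

text \<open>
  The three vectors are part of a basis. On each of them the matrix has \<open>q\<close> possible values, on
  the other \<open>n - 3\<close> basis vectors it is arbitrary.
\<close>

lemma card_common_eigen_mats_indep3:
  fixes u v w :: "'a::{field,finite} ^ 'n"
  assumes i: "indep3 u v w"
  shows "card (common_eigen_mats {u, v, w}) = CARD('a) ^ (3 + CARD('n) * (CARD('n) - 3))"
proof -
  obtain B where B: "{u, v, w} \<subseteq> B" "vec.independent B" "vec.span B = UNIV" "card B = CARD('n)"
    using extend_to_basis independent_triple(1) [OF i] by blast
  let ?S = "\<lambda>b. if b \<in> {u, v, w} then vec.span {b} else UNIV"
  have nz: "b \<noteq> 0" if "b \<in> {u, v, w}" for b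
    using that independent_triple(1) [OF i] by (metis vec.dependent_zero)
  have "(\<forall>b\<in>B. f b \<in> (if b \<in> A then g b else UNIV)) \<longleftrightarrow> (\<forall>b\<in>A. f b \<in> g b)"
    if "A \<subseteq> B" for f A and g :: "_ \<Rightarrow> ('a ^ 'n) set"
    using that by auto
  from this [OF B(1)] have "common_eigen_mats {u, v, w} = {M. \<forall>b\<in>B. M *v b \<in> ?S b}"
    unfolding common_eigen_mats_def by simp
  then have "card (common_eigen_mats {u, v, w}) = (\<Prod>b\<in>B. card (?S b))"
    by (simp only: card_matrices_prescribed [OF B(2,3)])
  also have "\<dots> = (\<Prod>b\<in>{u, v, w}. card (?S b)) * (\<Prod>b\<in>B - {u, v, w}. card (?S b))"
    by (subst mult.commute, rule prod.subset_diff) (use B in auto)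
  also have "(\<Prod>b\<in>{u, v, w}. card (?S b)) = (\<Prod>b\<in>{u, v, w}. CARD('a))"
    by (rule prod.cong) (use nz card_span_singleton in auto)
  also have "\<dots> = CARD('a) ^ 3"
    using independent_triple(2) [OF i] by (simp only: prod_constant)
  also have "(\<Prod>b\<in>B - {u, v, w}. card (?S b)) = (\<Prod>b\<in>B - {u, v, w}. CARD('a ^ 'n))"
    by (rule prod.cong) auto
  also have "\<dots> = CARD('a ^ 'n) ^ (CARD('n) - 3)"
    using card_Diff_subset [OF _ B(1)] B(4) independent_triple(2) [OF i] by simp
  finally show ?thesis by (simp add: power_add power_mult)
qed

text \<open>
  The matrices that act on \<open>u\<close> and \<open>v\<close> as the same scalar have the whole plane spanned by \<open>u\<close> and
  \<open>v\<close> inside an eigenspace. There are \<open>q\<close> choices for the scalar, and \<open>n - 2\<close> basis vectors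
  remain arbitrary.
\<close>

lemma card_common_eigen_mats_line:
  fixes u v :: "'a::{field,finite} ^ 'n"
  assumes i: "indep2 u v"
  shows "card (common_eigen_mats {u, v, c *s u + d *s v}) \<ge> CARD('a) ^ (1 + CARD('n) * (CARD('n) - 2))"
proof -
  obtain B where B: "{u, v} \<subseteq> B" "vec.independent B" "vec.span B = UNIV" "card B = CARD('n)"
    using extend_to_basis independent_pair(1) [OF i] by blast
  let ?S = "\<lambda>k b. if b \<in> {u, v} then {k *s b} else UNIV"
  let ?M = "\<lambda>k. {M :: 'a ^ 'n ^ 'n. \<forall>b\<in>B. M *v b \<in> ?S k b}"
  have card: "card (?M k) = CARD('a) ^ (CARD('n) * (CARD('n) - 2))" for k
  proof -
    have "card (?M k) = (\<Prod>b\<in>B. card (?S k b))"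
      by (rule card_matrices_prescribed [OF B(2,3)])
    also have "\<dots> = (\<Prod>b\<in>{u, v}. card (?S k b)) * (\<Prod>b\<in>B - {u, v}. card (?S k b))"
      by (subst mult.commute, rule prod.subset_diff) (use B in auto)
    also have "(\<Prod>b\<in>{u, v}. card (?S k b)) = 1"
      by (rule prod.neutral) auto
    also have "(\<Prod>b\<in>B - {u, v}. card (?S k b)) = (\<Prod>b\<in>B - {u, v}. CARD('a ^ 'n))"
      by (rule prod.cong) auto
    also have "\<dots> = CARD('a ^ 'n) ^ (CARD('n) - 2)"
      using card_Diff_subset [OF _ B(1)] B(4) independent_pair(2) [OF i] by (simp add: numeral_2_eq_2)
    finally show ?thesis by (simp add: power_mult)
  qed
  have u: "M *v u = k *s u" "M *v v = k *s v" if "M \<in> ?M k" for M k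
    using that B(1) by auto
  have "?M k \<inter> ?M l = {}" if "k \<noteq> l" for k l
  proof -
    have "M \<notin> ?M k \<inter> ?M l" for M
    proof
      assume "M \<in> ?M k \<inter> ?M l"
      then have "k *s u = l *s u" using u(1) [of M k] u(1) [of M l] by force
      then show False using that indep2_nonzero [OF i] by simp
    qed
    then show ?thesis by blast
  qed
  then have "card (\<Union>k\<in>UNIV. ?M k) = (\<Sum>k\<in>(UNIV :: 'a set). card (?M k))"
    by (intro card_UN_disjoint) auto
  also have "\<dots> = CARD('a) ^ (1 + CARD('n) * (CARD('n) - 2))"
    by (simp only: card sum_constant) simp
  finally have "card (\<Union>k\<in>UNIV. ?M k) = CARD('a) ^ (1 + CARD('n) * (CARD('n) - 2))" .
  moreover have "(\<Union>k\<in>UNIV. ?M k) \<subseteq> common_eigen_mats {u, v, c *s u + d *s v}"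
  proof
    fix M assume "M \<in> (\<Union>k\<in>UNIV. ?M k)"
    then obtain k where "M \<in> ?M k" by blast
    then have M: "M *v u = k *s u" "M *v v = k *s v" using u by auto
    have "M *v (c *s u + d *s v) = k *s (c *s u + d *s v)"
      by (simp add: vec.add vec.scale M vector_add_ldistrib vector_smult_assoc mult.commute)
    then show "M \<in> common_eigen_mats {u, v, c *s u + d *s v}"
      using M by (auto simp: common_eigen_mats_def vec.span_singleton)
  qed
  then have "card (\<Union>k\<in>UNIV. ?M k) \<le> card (common_eigen_mats {u, v, c *s u + d *s v})"
    by (intro card_mono) auto
  ultimately show ?thesis by (simp only:)
qed

lemma not_indep3_in_line:
  assumes uv: "indep2 u v" and n: "\<not> indep3 u v w"
  obtains c d where "w = c *s u + d *s v"
proof -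
  obtain c d e where e: "c *s u + d *s v + e *s w = 0" "\<not> (c = 0 \<and> d = 0 \<and> e = 0)"
    using n by (auto simp: indep3_def)
  have "e \<noteq> 0" using e indep2D [OF uv, of c d] by auto
  then have "w = inverse e *s (e *s w)" by (simp add: vector_smult_assoc)
  also have "e *s w = - (c *s u + d *s v)" unfolding eq_neg_iff_add_eq_0 add.commute [of "e *s w"] by (rule e(1))
  also have "inverse e *s - (c *s u + d *s v) = (- (inverse e * c)) *s u + (- (inverse e * d)) *s v"
    by (simp add: vec_eq_iff algebra_simps)
  finally show thesis by (rule that)
qed

text \<open>
  Having three independent eigenvectors imposes more conditions than acting as a scalar on a plane:
  \<open>1 + n (n - 2) > 3 + n (n - 3)\<close> exactly when \<open>n > 2\<close>. So the number of matrices separates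
  the two cases, over every finite field.
\<close>

lemma indep3_iff_card_common_eigen_mats:
  fixes u v w :: "'a::{field,finite} ^ 'n"
  assumes n: "CARD('n) \<ge> 3" and uv: "indep2 u v"
  shows "indep3 u v w \<longleftrightarrow> card (common_eigen_mats {u, v, w}) = CARD('a) ^ (3 + CARD('n) * (CARD('n) - 3))"
proof
  assume eq: "card (common_eigen_mats {u, v, w}) = CARD('a) ^ (3 + CARD('n) * (CARD('n) - 3))"
  show "indep3 u v w"
  proof (rule ccontr)
    assume "\<not> indep3 u v w"
    then obtain c d where "w = c *s u + d *s v" using not_indep3_in_line uv by blast
    then have le: "CARD('a) ^ (1 + CARD('n) * (CARD('n) - 2)) \<le> CARD('a) ^ (3 + CARD('n) * (CARD('n) - 3))"
      using card_common_eigen_mats_line [OF uv, of c d] eq by simp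
    obtain m where m: "CARD('n) = m + 3" using n by (metis add.commute le_Suc_ex)
    have "card {0, 1 :: 'a} \<le> CARD('a)" by (intro card_mono) auto
    then have "1 < CARD('a)" by simp
    from power_le_imp_le_exp [OF this le] show False by (simp add: m algebra_simps)
  qed
qed (rule card_common_eigen_mats_indep3)

section \<open>Graph automorphisms\<close>

definition common_nbrs :: "'v set \<Rightarrow> 'v set set \<Rightarrow> 'v set \<Rightarrow> 'v set" where
  "common_nbrs V E A = {x \<in> V. \<forall>a\<in>A. {x, a} \<in> E}"

lemma card_common_nbrs_graph_aut:
  assumes f: "f \<in> graph_aut V E" and A: "A \<subseteq> V"
  shows "card (common_nbrs V E (f ` A)) = card (common_nbrs V E A)"
proof -
  have bij: "bij_betw f V V" and edge: "\<And>u w. u \<in> V \<Longrightarrow> w \<in> V \<Longrightarrow> {u, w} \<in> E \<longleftrightarrow> {f u, f w} \<in> E"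
    using f by (auto simp: graph_aut_def Bij_def)
  have "common_nbrs V E (f ` A) = f ` common_nbrs V E A"
  proof
    show "f ` common_nbrs V E A \<subseteq> common_nbrs V E (f ` A)"
      using bij edge A by (fastforce simp: common_nbrs_def bij_betw_def)
    show "common_nbrs V E (f ` A) \<subseteq> f ` common_nbrs V E A"
    proof
      fix y assume y: "y \<in> common_nbrs V E (f ` A)"
      then obtain x where x: "x \<in> V" "y = f x"
        using bij by (auto simp: common_nbrs_def bij_betw_def)
      then have "x \<in> common_nbrs V E A" using y edge A by (auto simp: common_nbrs_def)
      then show "y \<in> f ` common_nbrs V E A" using x by blast
    qed
  qed
  moreover have "inj_on f (common_nbrs V E A)"
    using bij by (auto simp: common_nbrs_def bij_betw_def inj_on_def)
  ultimately show ?thesis by (simp add: card_image)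
qed

lemma graph_aut_group: "group (graph_Aut V E)"
proof -
  have "subgroup (graph_aut V E) (BijGroup V)"
  proof
    show "graph_aut V E \<subseteq> carrier (BijGroup V)" by (auto simp: graph_aut_def BijGroup_def)
    show "\<one>\<^bsub>BijGroup V\<^esub> \<in> graph_aut V E" by (auto simp: graph_aut_def BijGroup_def id_Bij)
    show "f \<otimes>\<^bsub>BijGroup V\<^esub> g \<in> graph_aut V E" if fg: "f \<in> graph_aut V E" "g \<in> graph_aut V E" for f g
    proof -
      have B: "f \<in> Bij V" "g \<in> Bij V" using fg by (auto simp: graph_aut_def)
      then have "g x \<in> V" if "x \<in> V" for x using that Bij_imp_funcset by blast
      then show ?thesis using fg B compose_Bij [OF B]
        by (simp add: graph_aut_def BijGroup_def compose_eq)
    qed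
    show "inv\<^bsub>BijGroup V\<^esub> f \<in> graph_aut V E" if f: "f \<in> graph_aut V E" for f
    proof -
      have B: "f \<in> Bij V" using f by (auto simp: graph_aut_def)
      have V: "inv_into V f x \<in> V" "f (inv_into V f x) = x" if "x \<in> V" for x
        using that B by (auto simp: Bij_def bij_betw_def inv_into_into f_inv_into_f)
      have "{u, w} \<in> E \<longleftrightarrow> {inv_into V f u, inv_into V f w} \<in> E" if "u \<in> V" "w \<in> V" for u w
      proof -
        have "{inv_into V f u, inv_into V f w} \<in> E \<longleftrightarrow> {f (inv_into V f u), f (inv_into V f w)} \<in> E"
          using f V that by (simp add: graph_aut_def)
        then show ?thesis using V that by simp
      qed
      then show ?thesis
        using B restrict_inv_into_Bij [OF B] by (simp add: inv_BijGroup graph_aut_def)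
    qed
  qed
  then show ?thesis
    unfolding graph_Aut_def by (rule group.subgroup_imp_group [OF group_BijGroup])
qed

section \<open>The spectral incidence graph\<close>

lemma mat_scale_mult_vec: "mat_scale k M *v v = k *s (M *v v)"
  by (simp add: mat_scale_def matrix_vector_mult_def vec_eq_iff sum_distrib_left mult.assoc)

lemma eigenvec_iff: "eigenvec M v \<longleftrightarrow> v \<noteq> 0 \<and> M *v v \<in> vec.span {v}"
  by (auto simp: eigenvec_def vec.span_singleton)

text \<open>
  Adjacency does not depend on the chosen generators of the two lines.
\<close>

lemma SIG_edge_iff:
  fixes M :: "'a::field ^ 'n ^ 'n"
  shows "{Inl (mat_span {M}), Inr (vec.span {v})} \<in> SIG_edges \<longleftrightarrow> M \<noteq> 0 \<and> eigenvec M v"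
proof
  assume "M \<noteq> 0 \<and> eigenvec M v"
  then show "{Inl (mat_span {M}), Inr (vec.span {v})} \<in> SIG_edges"
    unfolding SIG_edges_def mats_with_eigenvec_def by blast
next
  assume "{Inl (mat_span {M}), Inr (vec.span {v})} \<in> SIG_edges"
  then obtain M' v' where M': "mat_span {M} = mat_span {M'}" "M' \<noteq> 0"
    and v': "vec.span {v} = vec.span {v'}" "eigenvec M' v'"
    unfolding SIG_edges_def mats_with_eigenvec_def by (auto simp: doubleton_eq_iff)
  obtain k where k: "M = mat_scale k M'"
    using M' matvs.span_base [of M "{M}"] by (auto simp: matvs.span_singleton)
  obtain c where c: "M' = mat_scale c M"
    using M' matvs.span_base [of M' "{M'}"] by (auto simp: matvs.span_singleton)
  obtain d where d: "d \<noteq> 0" "v' = d *s v" using v' span_singleton_eq_iff by metis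
  obtain e where e: "v = e *s v'" using v' span_singleton_eq_iff by metis
  obtain l where l: "M' *v v' = l *s v'" "v' \<noteq> 0" using v' by (auto simp: eigenvec_def)
  have "M *v v = (k * l) *s v"
    by (simp add: k e mat_scale_mult_vec vec.scale l vector_smult_assoc mult_ac)
  moreover have "M \<noteq> 0"
    using c M'(2) by (metis matvs.scale_zero_right)
  moreover have "v \<noteq> 0" using d l by auto
  ultimately show "M \<noteq> 0 \<and> eigenvec M v" by (auto simp: eigenvec_def)
qed

lemma SIG_edge_Inr: "{Inr p, Inr r} \<notin> SIG_edges" and SIG_edge_Inl: "{Inl m, Inl m'} \<notin> SIG_edges"
  by (auto simp: SIG_edges_def doubleton_eq_iff)

text \<open>
  The common eigenmatrices of a set of vectors form a subspace, whose nonzero elements are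
  partitioned by the lines that they generate. These lines are the common neighbours of the points,
  so the size of the subspace is an invariant of the graph.
\<close>

lemma card_common_eigen_mats_nbrs:
  fixes S :: "('a::{field,finite} ^ 'n) set"
  assumes S: "S \<noteq> {}" "0 \<notin> S"
  shows "card (common_eigen_mats S) =
    1 + card (common_nbrs SIG_verts SIG_edges ((\<lambda>v. Inr (vec.span {v})) ` S)) * (CARD('a) - 1)"
proof -
  let ?N = "common_nbrs SIG_verts SIG_edges ((\<lambda>v. Inr (vec.span {v})) ` S)"
  have N: "?N = (\<lambda>M. Inl (mat_span {M})) ` (common_eigen_mats S - {0})" (is "_ = ?I")
  proof
    show "?N \<subseteq> ?I"
    proof
      fix x assume x: "x \<in> ?N"
      then obtain v where v: "v \<in> S" "{x, Inr (vec.span {v})} \<in> SIG_edges"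
        using S by (auto simp: common_nbrs_def)
      have "x \<in> SIG_verts" using x by (simp add: common_nbrs_def)
      then obtain M where M: "x = Inl (mat_span {M})"
        using v(2) SIG_edge_Inr unfolding SIG_verts_def mat_points_def by blast
      then have "\<forall>v\<in>S. M \<noteq> 0 \<and> eigenvec M v" using x SIG_edge_iff by (auto simp: common_nbrs_def)
      then have "M \<in> common_eigen_mats S - {0}" using S by (auto simp: common_eigen_mats_def eigenvec_iff)
      then show "x \<in> ?I" using M by blast
    qed
    show "?I \<subseteq> ?N"
    proof
      fix x assume "x \<in> ?I"
      then obtain M where M: "x = Inl (mat_span {M})" "M \<in> common_eigen_mats S" "M \<noteq> 0" by blast
      have "\<forall>v\<in>S. eigenvec M v" using M(2) S by (auto simp: common_eigen_mats_def eigenvec_iff)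
      moreover then have "x \<in> SIG_verts"
        using M S by (auto simp: SIG_verts_def mat_points_def mats_with_eigenvec_def)
      ultimately show "x \<in> ?N" using M SIG_edge_iff by (auto simp: common_nbrs_def)
    qed
  qed
  have zero: "0 \<in> common_eigen_mats S" by (simp add: common_eigen_mats_def vec.span_zero)
  have scale: "mat_scale k M \<in> common_eigen_mats S" if "M \<in> common_eigen_mats S" for k M
    using that by (simp add: common_eigen_mats_def mat_scale_mult_vec vec.span_scale)
  define line where "line M = (\<lambda>k. mat_scale k M) ` (UNIV - {0})" for M :: "'a ^ 'n ^ 'n"
  have line: "mat_span {M} - {0} = line M" if "M \<noteq> 0" for M :: "'a ^ 'n ^ 'n"
    using that by (auto simp: line_def matvs.span_singleton)
  have card_line: "card (mat_span {M} - {0}) = CARD('a) - 1" if "M \<noteq> 0" for M :: "'a ^ 'n ^ 'n"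
  proof -
    have "inj_on (\<lambda>k. mat_scale k M) (UNIV - {0})" using that by (auto simp: inj_on_def)
    then show ?thesis using that by (simp add: line line_def card_image card_Diff_subset)
  qed
  have span_mem: "mat_span {L} = mat_span {M}" if LM: "L \<in> mat_span {M}" "L \<noteq> 0" for L M :: "'a ^ 'n ^ 'n"
  proof -
    obtain k where k: "L = mat_scale k M" using LM by (auto simp: matvs.span_singleton)
    then have "k \<noteq> 0" using that by auto
    then have "M = mat_scale (inverse k) L" using k by simp
    then have "M \<in> mat_span {L}" by (metis matvs.span_base matvs.span_scale singletonI)
    then show ?thesis using that by (simp add: matvs.span_eq)
  qed
  have "common_eigen_mats S - {0} = (\<Union>x\<in>?N. projl x - {0})"
    unfolding N using scale matvs.span_base by (fastforce simp: matvs.span_singleton)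
  also have "card \<dots> = (\<Sum>x\<in>?N. card (projl x - {0}))"
  proof (rule card_UN_disjoint)
    show "\<forall>x\<in>?N. \<forall>y\<in>?N. x \<noteq> y \<longrightarrow> (projl x - {0}) \<inter> (projl y - {0}) = {}"
    proof (intro ballI impI, rule ccontr)
      fix x y assume x: "x \<in> ?N" and y: "y \<in> ?N" and "x \<noteq> y"
        and "(projl x - {0}) \<inter> (projl y - {0}) \<noteq> {}"
      then obtain L where L: "L \<in> projl x" "L \<in> projl y" "L \<noteq> 0" by blast
      obtain M M' where M: "x = Inl (mat_span {M})" "y = Inl (mat_span {M'})" using x y N by blast
      then have "mat_span {L} = mat_span {M}" "mat_span {L} = mat_span {M'}"
        using span_mem [of L M] span_mem [of L M'] L by simp_all
      then show False using M \<open>x \<noteq> y\<close> by simp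
    qed
  qed auto
  also have "\<dots> = (\<Sum>x\<in>?N. CARD('a) - 1)"
  proof (rule sum.cong [OF refl])
    fix x assume "x \<in> ?N"
    then obtain M where "x = Inl (mat_span {M})" "M \<noteq> 0" unfolding N by blast
    then show "card (projl x - {0}) = CARD('a) - 1" using card_line by simp
  qed
  finally have "card (common_eigen_mats S - {0}) = card ?N * (CARD('a) - 1)"
    by (simp only: sum_constant of_nat_id)
  then show ?thesis using zero card_Suc_Diff1 [of "common_eigen_mats S" 0] by simp
qed

section \<open>Automorphisms of the graph act on points by collineations\<close>

lemma SIG_verts_Inr_iff: "Inr p \<in> SIG_verts \<longleftrightarrow> p \<in> proj_points"
  by (auto simp: SIG_verts_def)

lemma span_in_proj_points: "v \<noteq> 0 \<Longrightarrow> vec.span {v} \<in> proj_points"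
  by (auto simp: proj_points_def)

lemma rank_one_matrix:
  fixes u :: "'a::field ^ 'n"
  obtains M where "\<And>x. M *v x = (x $ a) *s u"
proof
  show "(\<chi> i j. if j = a then u $ i else 0) *v x = (x $ a) *s u" for x
    by (simp add: matrix_vector_mult_def vec_eq_iff if_distrib if_distribR mult.commute cong: if_cong)
qed

text \<open>
  The identity matrix is adjacent to every point. If its image is a matrix, then the image of
  every point has a matrix as neighbour and is a point. If its image were a point \<open>\<langle>w\<rangle>\<close>, then
  \<open>\<phi>\<close> would map points to matrices, and then matrices to points, so that \<open>w\<close> would be an
  eigenvector of every matrix vertex; but a suitable matrix of rank one has an eigenvector in its
  kernel without having \<open>w\<close> as an eigenvector.
\<close>

lemma SIG_aut_point:
  fixes \<phi> :: "('a::field, 'n::finite) sig_vertex \<Rightarrow> ('a, 'n) sig_vertex"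
  assumes n: "CARD('n) \<ge> 2" and \<phi>: "\<phi> \<in> graph_aut SIG_verts SIG_edges" and v: "v \<noteq> 0"
  obtains w where "w \<noteq> 0" "\<phi> (Inr (vec.span {v})) = Inr (vec.span {w})"
proof -
  have bij: "bij_betw \<phi> SIG_verts SIG_verts"
    and edge: "\<And>x y. x \<in> SIG_verts \<Longrightarrow> y \<in> SIG_verts \<Longrightarrow> {x, y} \<in> SIG_edges \<longleftrightarrow> {\<phi> x, \<phi> y} \<in> SIG_edges"
    using \<phi> by (auto simp: graph_aut_def Bij_def)
  have in_verts: "\<phi> x \<in> SIG_verts" if "x \<in> SIG_verts" for x using that bij by (auto simp: bij_betw_def)
  define I where "I = (Inl (mat_span {mat 1}) :: ('a, 'n) sig_vertex)"
  have one: "(mat 1 :: 'a ^ 'n ^ 'n) \<noteq> 0" by (simp add: mat_def vec_eq_iff)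
  have ev: "eigenvec (mat 1) x" if "x \<noteq> 0" for x :: "'a ^ 'n"
    using that by (auto simp: eigenvec_iff vec.span_base)
  have I_edge: "{I, Inr (vec.span {x})} \<in> SIG_edges" if "x \<noteq> 0" for x
    unfolding I_def SIG_edge_iff using one ev [OF that] by blast
  have I: "I \<in> SIG_verts"
    using one ev [OF v] by (auto simp: I_def SIG_verts_def mat_points_def mats_with_eigenvec_def)
  have image_edge: "{\<phi> I, \<phi> (Inr (vec.span {x}))} \<in> SIG_edges" if "x \<noteq> 0" for x
    using edge [OF I, of "Inr (vec.span {x})"] I_edge [OF that] span_in_proj_points [OF that]
    by (simp add: SIG_verts_Inr_iff)
  have v_vert: "Inr (vec.span {v}) \<in> SIG_verts"
    using span_in_proj_points [OF v] by (simp add: SIG_verts_Inr_iff)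
  consider m where "\<phi> I = Inl m" | r where "\<phi> I = Inr r" by (cases "\<phi> I") auto
  then show thesis
  proof cases
    case 1
    then obtain p where p: "\<phi> (Inr (vec.span {v})) = Inr p"
      using image_edge [OF v] SIG_edge_Inl by (cases "\<phi> (Inr (vec.span {v}))") auto
    then have "p \<in> proj_points" using in_verts [OF v_vert] by (simp add: SIG_verts_Inr_iff)
    then show thesis using that p by (auto simp: proj_points_def)
  next
    case 2
    then have "r \<in> proj_points" using in_verts [OF I] by (simp add: SIG_verts_Inr_iff)
    then obtain w where w: "r = vec.span {w}" "w \<noteq> 0" by (auto simp: proj_points_def)
    obtain a where a: "w $ a \<noteq> 0" using w by (auto simp: vec_eq_iff)
    obtain b where b: "b \<noteq> a"
    proof -
      have "\<not> UNIV \<subseteq> {a}" using n card_mono [of "{a}" UNIV] by auto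
      then show thesis using that by blast
    qed
    \<comment> \<open>The matrix \<open>x \<mapsto> x\<^sub>a u\<close> maps \<open>u\<close> to \<open>0\<close>, and \<open>w\<close> to a nonzero multiple of \<open>u\<close>, which is not
      a multiple of \<open>w\<close>.\<close>
    define u where "u = (axis b 1 :: 'a ^ 'n)"
    have u: "u \<noteq> 0" "u $ a = 0" using b by (auto simp: u_def axis_def vec_eq_iff)
    obtain M where M: "\<And>x. M *v x = (x $ a) *s u" using rank_one_matrix [of a u] by blast
    have "M *v w \<noteq> 0" using M a u by simp
    then have M0: "M \<noteq> 0" by auto
    have Mu: "eigenvec M u" using M u by (simp add: eigenvec_iff vec.span_zero)
    have "\<not> eigenvec M w"
    proof
      assume "eigenvec M w"
      then obtain c where c: "(w $ a) *s u = c *s w" using M by (auto simp: eigenvec_def)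
      then have "((w $ a) *s u) $ a = (c *s w) $ a" by simp
      then have "c = 0" using a u by simp
      then show False using c a u by simp
    qed
    then have no_edge: "{Inl (mat_span {M}), \<phi> I} \<notin> SIG_edges"
      by (simp add: 2 w SIG_edge_iff)
    have "Inl (mat_span {M}) \<in> SIG_verts"
      using M0 Mu by (auto simp: SIG_verts_def mat_points_def mats_with_eigenvec_def)
    \<comment> \<open>If \<open>x\<close> were a matrix, it would have a point as neighbour, and their images would be two
      adjacent matrices. If it were a point, its image would be adjacent to that of the identity.\<close>
    then obtain x where x: "x \<in> SIG_verts" "\<phi> x = Inl (mat_span {M})"
      using bij unfolding bij_betw_def by (metis imageE)
    consider N where "x = Inl (mat_span {N})" "N \<in> mats_with_eigenvec" | z where "x = Inr (vec.span {z})" "z \<noteq> 0"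
      using x(1) by (auto simp: SIG_verts_def mat_points_def proj_points_def)
    then have False
    proof cases
      case 1
      then obtain z where z: "N \<noteq> 0" "eigenvec N z" by (auto simp: mats_with_eigenvec_def)
      then have z0: "z \<noteq> 0" by (simp add: eigenvec_def)
      then have "{\<phi> x, \<phi> (Inr (vec.span {z}))} \<in> SIG_edges"
        using edge [OF x(1), of "Inr (vec.span {z})"] z 1 span_in_proj_points SIG_edge_iff
        by (auto simp: SIG_verts_Inr_iff)
      moreover obtain m where "\<phi> (Inr (vec.span {z})) = Inl m"
        using image_edge [OF z0] 2 SIG_edge_Inr by (cases "\<phi> (Inr (vec.span {z}))") auto
      ultimately show False using x SIG_edge_Inl by auto
    next
      case 2
      then show False using image_edge [of z] no_edge x by (simp add: insert_commute)
    qed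
    then show thesis ..
  qed
qed

text \<open>
  Both \<open>T\<close> and \<open>\<sigma>\<close> are injective as soon as their kernels are trivial, and over a finite field
  they are then bijective.
\<close>

lemma semilinear_autI:
  fixes T :: "'a::{field,finite} ^ 'n \<Rightarrow> 'a ^ 'n"
  assumes \<sigma>: "\<sigma> 1 = 1" "\<And>c d. \<sigma> (c + d) = \<sigma> c + \<sigma> d" "\<And>c d. \<sigma> (c * d) = \<sigma> c * \<sigma> d"
    and T: "\<And>u v. T (u + v) = T u + T v" "\<And>c v. T (c *s v) = \<sigma> c *s T v"
    and nz: "\<And>v. v \<noteq> 0 \<Longrightarrow> T v \<noteq> 0"
  shows "semilinear_aut T"
proof -
  have "inj T"
  proof (rule injI, rule ccontr)
    fix u v assume eq: "T u = T v" and "u \<noteq> v"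
    then have "T (u - v) \<noteq> 0" using nz by simp
    moreover have "T u = T (u - v) + T v" by (simp only: T(1) [symmetric] diff_add_cancel)
    ultimately show False using eq by simp
  qed
  then have "bij T" by (simp add: bij_def finite_UNIV_inj_surj)
  have "\<sigma> 0 = 0" by (rule add_left_imp_eq [of "\<sigma> 0"]) (simp add: \<sigma>(2) [symmetric])
  have \<sigma>nz: "\<sigma> c \<noteq> 0" if "c \<noteq> 0" for c
  proof
    assume "\<sigma> c = 0"
    then have "\<sigma> (c * inverse c) = 0" by (simp only: \<sigma>(3)) simp
    then show False using that \<sigma>(1) by simp
  qed
  have "inj \<sigma>"
  proof (rule injI, rule ccontr)
    fix c d assume eq: "\<sigma> c = \<sigma> d" and "c \<noteq> d"
    then have "\<sigma> (c - d) \<noteq> 0" using \<sigma>nz by simp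
    moreover have "\<sigma> c = \<sigma> (c - d) + \<sigma> d" by (simp only: \<sigma>(2) [symmetric] diff_add_cancel)
    ultimately show False using eq by simp
  qed
  then have "bij \<sigma>" by (simp add: bij_def finite_UNIV_inj_surj)
  then have "\<sigma> \<in> field_aut" unfolding field_aut_def using \<sigma> by blast
  then show ?thesis unfolding semilinear_aut_def using \<open>bij T\<close> T by blast
qed

text \<open>
  Points are mapped to points, and collinear triples are those with many common neighbours; hence
  an automorphism of the graph is a collineation, and the fundamental theorem applies.
\<close>

theorem SIG_aut_semilinear:
  fixes \<phi> :: "('a::{field,finite}, 'n::finite) sig_vertex \<Rightarrow> ('a, 'n) sig_vertex"
  assumes n: "CARD('n) \<ge> 3" and \<phi>: "\<phi> \<in> graph_aut SIG_verts SIG_edges"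
  obtains T where "semilinear_aut T" "\<And>v. v \<noteq> 0 \<Longrightarrow> \<phi> (Inr (vec.span {v})) = Inr (vec.span {T v})"
proof -
  have bij: "bij_betw \<phi> SIG_verts SIG_verts" using \<phi> by (auto simp: graph_aut_def Bij_def)
  have "\<exists>w. w \<noteq> 0 \<and> \<phi> (Inr (vec.span {v})) = Inr (vec.span {w})" if "v \<noteq> 0" for v
    by (rule SIG_aut_point [OF _ \<phi> that]) (use n in auto)
  then obtain g where g: "\<And>v. v \<noteq> 0 \<Longrightarrow> g v \<noteq> 0"
    "\<And>v. v \<noteq> 0 \<Longrightarrow> \<phi> (Inr (vec.span {v})) = Inr (vec.span {g v})" by metis
  have g_span: "vec.span {g u} = vec.span {g v} \<longleftrightarrow> vec.span {u} = vec.span {v}" if uv: "u \<noteq> 0" "v \<noteq> 0" for u v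
  proof -
    have "\<phi> (Inr (vec.span {u})) = \<phi> (Inr (vec.span {v})) \<longleftrightarrow> Inr (vec.span {u}) = (Inr (vec.span {v}) :: ('a, 'n) sig_vertex)"
      using bij uv span_in_proj_points
      by (intro inj_on_eq_iff [of \<phi> SIG_verts]) (auto simp: SIG_verts_Inr_iff bij_betw_def)
    then show ?thesis using g(2) uv by simp
  qed
  have g_indep2: "indep2 (g u) (g v)" if "indep2 u v" for u v
    using that g_span indep2_nonzero [OF that] g(1) by (simp add: indep2_iff_span)
  have g_card: "card (common_eigen_mats {g u, g v, g w}) = card (common_eigen_mats {u, v, w})"
    if nz: "u \<noteq> 0" "v \<noteq> 0" "w \<noteq> 0" for u v w
  proof -
    let ?P = "\<lambda>S. (\<lambda>v. Inr (vec.span {v}) :: ('a, 'n) sig_vertex) ` S"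
    have im: "\<phi> ` ?P {u, v, w} = ?P {g u, g v, g w}" using g(2) nz by simp
    have "?P {u, v, w} \<subseteq> SIG_verts"
      using nz span_in_proj_points by (auto simp: SIG_verts_Inr_iff)
    from card_common_nbrs_graph_aut [OF \<phi> this]
    have "card (common_nbrs SIG_verts SIG_edges (?P {g u, g v, g w})) =
      card (common_nbrs SIG_verts SIG_edges (?P {u, v, w}))" by (simp only: im)
    moreover have "0 \<notin> {u, v, w}" "0 \<notin> {g u, g v, g w}" using nz g(1) by auto
    ultimately show ?thesis by (simp only: card_common_eigen_mats_nbrs insert_not_empty not_False_eq_True)
  qed
  have g_indep3: "indep3 (g u) (g v) (g w) \<longleftrightarrow> indep3 u v w" if "indep2 u v" "w \<noteq> 0" for u v w
    using indep3_iff_card_common_eigen_mats [OF n that(1), of w]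
      indep3_iff_card_common_eigen_mats [OF n g_indep2 [OF that(1)], of "g w"]
      g_card [OF indep2_nonzero [OF that(1)] that(2)] by simp
  have g_line: "g (c *s u + d *s v) \<in> vec.span {g u, g v}"
    if uv: "indep2 u v" and nz: "c *s u + d *s v \<noteq> 0" for u v c d
  proof -
    have "\<not> indep3 u v (c *s u + d *s v)"
    proof
      assume i: "indep3 u v (c *s u + d *s v)"
      have "c *s u + d *s v + (-1) *s (c *s u + d *s v) = 0" by simp
      from indep3D [OF i this] show False by simp
    qed
    then have "\<not> indep3 (g u) (g v) (g (c *s u + d *s v))" using g_indep3 uv nz by blast
    then obtain c' d' where "g (c *s u + d *s v) = c' *s g u + d' *s g v"
      using not_indep3_in_line [OF g_indep2 [OF uv]] by blast
    then show ?thesis by (auto simp: span_pair)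
  qed
  have indep3_first: "indep2 u v \<and> w \<noteq> 0" if i: "indep3 u v w" for u v w :: "'a ^ 'n"
  proof
    show "indep2 u v" unfolding indep2_def
    proof (intro allI impI)
      fix c d assume "c *s u + d *s v = 0"
      then have "c *s u + d *s v + 0 *s w = 0" by simp
      from indep3D [OF i this] show "c = 0 \<and> d = 0" by simp
    qed
    show "w \<noteq> 0" using indep3_pair [OF i] indep2_nonzero by blast
  qed
  have g_scale: "vec.span {g (c *s v)} = vec.span {g v}" if "c \<noteq> 0" "v \<noteq> 0" for c v
  proof -
    have "vec.span {v} = vec.span {c *s v}" using that span_singleton_eq_iff by blast
    then show ?thesis using g_span [of "c *s v" v] that by simp
  qed
  have g_indep3': "indep3 (g u) (g v) (g w)" if "indep3 u v w" for u v w
    using g_indep3 indep3_first that by blast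
  show thesis
  proof (rule fundamental_theorem_projective_geometry [of g, OF n g(1) g_scale g_line g_indep2 g_indep3'])
    fix T \<sigma> assume \<sigma>: "\<sigma> 1 = 1" "\<And>c d. \<sigma> (c + d) = \<sigma> c + \<sigma> d" "\<And>c d. \<sigma> (c * d) = \<sigma> c * \<sigma> d"
      and T: "\<And>u v. T (u + v) = T u + T v" "\<And>c v. T (c *s v) = \<sigma> c *s T v"
      and Tg: "\<And>v. v \<noteq> 0 \<Longrightarrow> vec.span {T v} = vec.span {g v}"
    have "T v \<noteq> 0" if v: "v \<noteq> 0" for v
    proof -
      obtain c where "g v = c *s T v" using Tg [OF v] span_singleton_eq_iff by blast
      then show ?thesis using g(1) [OF v] by auto
    qed
    then have "semilinear_aut T" using \<sigma> T by (intro semilinear_autI)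
    then show thesis using that g(2) Tg by simp
  qed
qed

section \<open>Semilinear automorphisms and their matrices\<close>

lemma field_autD:
  assumes "\<sigma> \<in> field_aut"
  shows "bij \<sigma>" "\<sigma> (x + y) = \<sigma> x + \<sigma> y" "\<sigma> (x * y) = \<sigma> x * \<sigma> y" "\<sigma> 0 = 0" "\<sigma> 1 = 1"
    "\<sigma> x = 0 \<longleftrightarrow> x = 0"
proof -
  have add: "\<sigma> (x + y) = \<sigma> x + \<sigma> y" and mult: "\<sigma> (x * y) = \<sigma> x * \<sigma> y" for x y
    using assms by (auto simp: field_aut_def)
  show bij: "bij \<sigma>" using assms by (simp add: field_aut_def)
  show zero: "\<sigma> 0 = 0" by (rule add_left_imp_eq [of "\<sigma> 0"]) (simp add: add [symmetric])
  show eq_0: "\<sigma> x = 0 \<longleftrightarrow> x = 0" for x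
    using inj_eq [OF bij_is_inj [OF bij], of x 0] zero by simp
  have "\<sigma> 1 * \<sigma> 1 = \<sigma> 1 * 1" by (simp add: mult [symmetric])
  then show "\<sigma> 1 = 1" using eq_0 [of 1] by simp
  show "\<sigma> (x + y) = \<sigma> x + \<sigma> y" "\<sigma> (x * y) = \<sigma> x * \<sigma> y" by (fact add, fact mult)
qed

lemma field_aut_sum: "\<sigma> \<in> field_aut \<Longrightarrow> \<sigma> (sum f S) = (\<Sum>i\<in>S. \<sigma> (f i))"
  using sum_comp_morphism [of \<sigma> f S] by (simp add: field_autD comp_def)

lemma map_vec_matrix_vector_mult:
  "\<sigma> \<in> field_aut \<Longrightarrow> map_vec \<sigma> (B *v x) = map_matrix \<sigma> B *v map_vec \<sigma> x"
  by (simp add: map_vec_def matrix_vector_mult_def vec_eq_iff field_aut_sum field_autD)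

lemma semilinear_matrix_aut:
  fixes A :: "'a::field ^ 'n ^ 'n"
  assumes A: "invertible A" and \<sigma>: "\<sigma> \<in> field_aut"
  shows "semilinear_aut (\<lambda>v. A *v map_vec \<sigma> v)"
proof -
  have "bij (map_vec \<sigma>)"
  proof (rule o_bij)
    show "map_vec (inv_into UNIV \<sigma>) \<circ> map_vec \<sigma> = id" "map_vec \<sigma> \<circ> map_vec (inv_into UNIV \<sigma>) = id"
      using field_autD(1) [OF \<sigma>]
      by (auto simp: map_vec_def fun_eq_iff vec_eq_iff bij_is_inj bij_is_surj surj_f_inv_f)
  qed
  moreover have "bij ((*v) A)"
  proof -
    obtain B where "A ** B = mat 1" "B ** A = mat 1" using A by (auto simp: invertible_def)
    then have "(*v) B \<circ> (*v) A = id" "(*v) A \<circ> (*v) B = id"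
      by (auto simp: fun_eq_iff matrix_vector_mul_assoc)
    then show ?thesis by (rule o_bij)
  qed
  ultimately have "bij ((*v) A \<circ> map_vec \<sigma>)" using bij_comp by blast
  then have "bij (\<lambda>v. A *v map_vec \<sigma> v)" by (simp add: comp_def)
  moreover have "map_vec \<sigma> (u + v) = map_vec \<sigma> u + map_vec \<sigma> v" "map_vec \<sigma> (c *s v) = \<sigma> c *s map_vec \<sigma> v"
    for u v :: "'a ^ 'n" and c
    by (simp_all add: map_vec_def vec_eq_iff field_autD [OF \<sigma>])
  ultimately show ?thesis unfolding semilinear_aut_def using \<sigma>
    by (intro conjI bexI [of _ \<sigma>]) (simp_all add: vec.add vec.scale)
qed

text \<open>
  The columns of \<open>A\<close> are the images of the basis vectors.
\<close>

lemma semilinear_aut_matrix: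
  assumes T: "semilinear_aut T"
  obtains A \<sigma> where "invertible A" "\<sigma> \<in> field_aut" "T = (\<lambda>v. A *v map_vec \<sigma> v)"
proof -
  obtain \<sigma> where \<sigma>: "\<sigma> \<in> field_aut" and bij: "bij T"
    and add: "\<And>u v. T (u + v) = T u + T v" and scale: "\<And>c v. T (c *s v) = \<sigma> c *s T v"
    using T unfolding semilinear_aut_def by blast
  define A where "A = (\<chi> i j. T (axis j 1) $ i)"
  have T0: "T 0 = 0" by (rule add_left_imp_eq [of "T 0"]) (simp add: add [symmetric])
  have T_eq: "T v = A *v map_vec \<sigma> v" for v
  proof -
    have "T v = T (\<Sum>j\<in>UNIV. v $ j *s axis j 1)" by (simp only: basis_expansion)
    also have "\<dots> = (\<Sum>j\<in>UNIV. T (v $ j *s axis j 1))"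
      using sum_comp_morphism [of T "\<lambda>j. v $ j *s axis j 1" UNIV] T0 add by (simp add: comp_def)
    also have "\<dots> = A *v map_vec \<sigma> v"
      by (simp add: scale A_def matrix_vector_mult_def map_vec_def vec_eq_iff mult.commute)
    finally show ?thesis .
  qed
  have "surj ((*v) A)"
  proof -
    have "range T \<subseteq> range ((*v) A)" using T_eq by auto
    then show ?thesis using bij_is_surj [OF bij] by auto
  qed
  then have "invertible A" using matrix_right_invertible_surjective invertible_right_inverse by blast
  then show thesis using that \<sigma> T_eq by blast
qed

lemma semilinear_aut_span:
  assumes T: "semilinear_aut T"
  shows "T ` vec.span {v} = vec.span {T v}"
proof -
  obtain \<sigma> where \<sigma>: "\<sigma> \<in> field_aut" and scale: "\<And>c v. T (c *s v) = \<sigma> c *s T v"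
    using T unfolding semilinear_aut_def by blast
  have "T ` vec.span {v} = (\<lambda>c. c *s T v) ` range \<sigma>"
    by (auto simp: vec.span_singleton scale image_image)
  then show ?thesis using bij_is_surj [OF field_autD(1) [OF \<sigma>]] by (simp add: vec.span_singleton)
qed

lemma semilinear_aut_nonzero_iff: "semilinear_aut T \<Longrightarrow> T v = 0 \<longleftrightarrow> v = 0"
proof -
  assume T: "semilinear_aut T"
  then have "bij T" and add: "\<And>u v. T (u + v) = T u + T v" by (auto simp: semilinear_aut_def)
  moreover have "T 0 = 0" by (rule add_left_imp_eq [of "T 0"]) (simp add: add [symmetric])
  ultimately show ?thesis using inj_eq [OF bij_is_inj, of T v 0] by simp
qed

lemma semilinear_aut_comp:
  assumes T: "semilinear_aut T" and U: "semilinear_aut U"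
  shows "semilinear_aut (T \<circ> U)"
proof -
  obtain \<sigma> where \<sigma>: "\<sigma> \<in> field_aut" "bij T"
    and T': "\<And>u v. T (u + v) = T u + T v" "\<And>c v. T (c *s v) = \<sigma> c *s T v"
    using T unfolding semilinear_aut_def by blast
  obtain \<tau> where \<tau>: "\<tau> \<in> field_aut" "bij U"
    and U': "\<And>u v. U (u + v) = U u + U v" "\<And>c v. U (c *s v) = \<tau> c *s U v"
    using U unfolding semilinear_aut_def by blast
  have "\<sigma> \<circ> \<tau> \<in> field_aut" using \<sigma> \<tau> by (auto simp: field_aut_def bij_comp)
  then show ?thesis unfolding semilinear_aut_def
    using bij_comp [OF \<tau>(2) \<sigma>(2)] by (intro conjI bexI [of _ "\<sigma> \<circ> \<tau>"]) (simp_all add: T' U')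
qed

text \<open>
  The permutation of the points induced by a semilinear automorphism. It is restricted to
  \<open>proj_points\<close> because the elements of \<open>BijGroup\<close> are extensional functions.
\<close>

definition proj_map :: "('a::field ^ 'n \<Rightarrow> 'a ^ 'n) \<Rightarrow> ('a ^ 'n) set \<Rightarrow> ('a ^ 'n) set" where
  "proj_map T = (\<lambda>p\<in>proj_points. T ` p)"

lemma proj_map_span: "semilinear_aut T \<Longrightarrow> v \<noteq> 0 \<Longrightarrow> proj_map T (vec.span {v}) = vec.span {T v}"
  by (simp add: proj_map_def span_in_proj_points semilinear_aut_span)

lemma proj_points_ext:
  assumes "f \<in> extensional proj_points" "g \<in> extensional proj_points"
    and "\<And>v. v \<noteq> 0 \<Longrightarrow> f (vec.span {v}) = g (vec.span {v})"
  shows "f = g"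
  using assms(1,2) by (rule extensionalityI) (use assms(3) in \<open>auto simp: proj_points_def\<close>)

lemma proj_map_Bij:
  fixes T :: "'a::field ^ 'n \<Rightarrow> 'a ^ 'n"
  assumes T: "semilinear_aut T"
  shows "proj_map T \<in> Bij proj_points"
proof -
  have bij: "bij T" using T by (simp add: semilinear_aut_def)
  have "bij_betw ((`) T) proj_points proj_points"
    unfolding bij_betw_def
  proof
    show "inj_on ((`) T) proj_points" 
      by (simp add: inj_on_def inj_image_eq_iff [OF bij_is_inj [OF bij]])
    show "(`) T ` proj_points = proj_points"
    proof
      show "(`) T ` proj_points \<subseteq> proj_points"

      proof clarify
        fix p :: "('a ^ 'n) set" assume "p \<in> proj_points"
        then obtain v where v: "p = vec.span {v}" "v \<noteq> 0" by (auto simp: proj_points_def)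
        then show "T ` p \<in> proj_points"
          using semilinear_aut_nonzero_iff [OF T] span_in_proj_points [of "T v"]
          by (simp add: semilinear_aut_span [OF T])
      qed
      show "proj_points \<subseteq> (`) T ` proj_points"
      proof
        fix p :: "('a ^ 'n) set" assume "p \<in> proj_points"
        then obtain v where v: "p = vec.span {v}" "v \<noteq> 0" by (auto simp: proj_points_def)
        obtain u where u: "v = T u" using bij_is_surj [OF bij] by (metis surjD)
        then have "u \<noteq> 0" using v semilinear_aut_nonzero_iff [OF T] by blast
        then show "p \<in> (`) T ` proj_points"
          using v u semilinear_aut_span [OF T] span_in_proj_points by blast
      qed
    qed
  qed
  then show ?thesis
    by (auto simp: Bij_def proj_map_def intro: bij_betw_cong [THEN iffD1])
qed

lemma proj_map_comp:
  fixes T U :: "'a::field ^ 'n \<Rightarrow> 'a ^ 'n"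
  assumes T: "semilinear_aut T" and U: "semilinear_aut U"
  shows "compose proj_points (proj_map T) (proj_map U) = proj_map (T \<circ> U)"
proof (rule proj_points_ext)
  fix v :: "'a ^ 'n" assume v: "v \<noteq> 0"
  then have "U v \<noteq> 0" using semilinear_aut_nonzero_iff U by blast
  then show "compose proj_points (proj_map T) (proj_map U) (vec.span {v}) = proj_map (T \<circ> U) (vec.span {v})"
    using v by (simp add: compose_def span_in_proj_points proj_map_span T U semilinear_aut_comp)
qed (simp_all add: proj_map_def compose_def)

section \<open>The projective semilinear group\<close>

abbreviation coset :: "'a::field ^ 'n ^ 'n \<Rightarrow> ('a ^ 'n ^ 'n) set" where
  "coset A \<equiv> scalar_mats #>\<^bsub>GLn\<^esub> A"

lemma mat_mult_eq_scale: "mat c ** A = mat_scale c A"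
  by (simp add: mat_def mat_scale_def matrix_matrix_mult_def vec_eq_iff if_distrib if_distribR cong: if_cong)

lemma coset_eq: "coset A = {mat_scale c A | c. c \<noteq> 0}"
  by (auto simp: r_coset_def GLn_def scalar_mats_def mat_mult_eq_scale)

lemma PGammaL_carrier:
  "carrier PGammaL = {(coset A, \<sigma>) | A \<sigma>. invertible A \<and> \<sigma> \<in> field_aut}"
  by (auto simp: PGammaL_def semidirect_product_def PGLn_def carrier_FactGroup field_Aut_def GLn_def)

lemma PGammaL_perm_eq_proj_map:
  fixes A :: "'a::field ^ 'n ^ 'n"
  assumes A: "invertible A" and \<sigma>: "\<sigma> \<in> field_aut"
  shows "PGammaL_perm (coset A, \<sigma>) = proj_map (\<lambda>v. A *v map_vec \<sigma> v)"
proof (rule proj_points_ext)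
  fix v :: "'a ^ 'n" assume "v \<noteq> 0"
  then show "PGammaL_perm (coset A, \<sigma>) (vec.span {v}) = proj_map (\<lambda>v. A *v map_vec \<sigma> v) (vec.span {v})"
    using PGammaL_perm_apply [OF \<sigma>] proj_map_span [OF semilinear_matrix_aut [OF A \<sigma>]] by simp
qed (simp_all add: PGammaL_perm_def proj_map_def)

lemma PGammaL_perms_carrier: "carrier PGammaL_perms = proj_map ` {T. semilinear_aut T}"
proof -
  have "PGammaL_perm ` carrier PGammaL \<subseteq> proj_map ` {T. semilinear_aut T}"
    using PGammaL_perm_eq_proj_map semilinear_matrix_aut by (fastforce simp: PGammaL_carrier)
  moreover have "proj_map T \<in> PGammaL_perm ` carrier PGammaL" if T: "semilinear_aut T" for T
  proof -
    obtain A \<sigma> where "invertible A" "\<sigma> \<in> field_aut" "T = (\<lambda>v. A *v map_vec \<sigma> v)"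
      using semilinear_aut_matrix T by blast
    then show ?thesis using PGammaL_perm_eq_proj_map by (force simp: PGammaL_carrier)
  qed
  ultimately show ?thesis by (auto simp: PGammaL_perms_def)
qed

text \<open>
  The twist \<open>[A, \<sigma>] [B, \<tau>] = [A B\<^sup>\<sigma>, \<sigma> \<tau>]\<close> is well defined on cosets because \<open>\<sigma>\<close> maps scalar
  multiples to scalar multiples.
\<close>

lemma PGammaL_mult:
  fixes A B :: "'a::field ^ 'n ^ 'n"
  assumes \<sigma>: "\<sigma> \<in> field_aut"
  shows "(coset A, \<sigma>) \<otimes>\<^bsub>PGammaL\<^esub> (coset B, \<tau>) = (coset (A ** map_matrix \<sigma> B), \<sigma> \<circ> \<tau>)"
proof -
  have scale: "mat_scale c A ** map_matrix \<sigma> (mat_scale d B) = mat_scale (c * \<sigma> d) (A ** map_matrix \<sigma> B)" for c d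
    by (simp add: mat_scale_def matrix_matrix_mult_def vec_eq_iff field_autD [OF \<sigma>] sum_distrib_left mult_ac)
  have mult_GLn: "X \<otimes>\<^bsub>GLn\<^esub> Y = X ** Y" for X Y :: "'a ^ 'n ^ 'n" by (simp add: GLn_def)
  have "coset A <#>\<^bsub>GLn\<^esub> (map_matrix \<sigma> ` coset B) = coset (A ** map_matrix \<sigma> B)"
  proof
    show "coset A <#>\<^bsub>GLn\<^esub> (map_matrix \<sigma> ` coset B) \<subseteq> coset (A ** map_matrix \<sigma> B)"
    proof
      fix X assume "X \<in> coset A <#>\<^bsub>GLn\<^esub> (map_matrix \<sigma> ` coset B)"
      then obtain Y Z where "Y \<in> coset A" "Z \<in> coset B" "X = Y ** map_matrix \<sigma> Z"
        by (auto simp: set_mult_def mult_GLn)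
      then obtain c d where "c \<noteq> 0" "d \<noteq> 0" "X = mat_scale c A ** map_matrix \<sigma> (mat_scale d B)"
        unfolding coset_eq by blast
      moreover from this have "c * \<sigma> d \<noteq> 0" using field_autD(6) [OF \<sigma>] by simp
      ultimately show "X \<in> coset (A ** map_matrix \<sigma> B)" unfolding scale coset_eq by blast
    qed
    show "coset (A ** map_matrix \<sigma> B) \<subseteq> coset A <#>\<^bsub>GLn\<^esub> (map_matrix \<sigma> ` coset B)"
    proof
      fix X assume "X \<in> coset (A ** map_matrix \<sigma> B)"
      then obtain c where c: "c \<noteq> 0" "X = mat_scale c A ** map_matrix \<sigma> (mat_scale 1 B)"
        unfolding scale by (auto simp: coset_eq field_autD [OF \<sigma>])
      have "mat_scale c A \<in> coset A" unfolding coset_eq using c(1) by blast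
      moreover have "mat_scale 1 B \<in> coset B" unfolding coset_eq using one_neq_zero by blast
      ultimately show "X \<in> coset A <#>\<^bsub>GLn\<^esub> (map_matrix \<sigma> ` coset B)"
        using c(2) by (auto simp: set_mult_def mult_GLn)
    qed
  qed
  then show ?thesis by (simp add: PGammaL_def semidirect_product_def PGLn_def field_Aut_def)
qed

lemma PGammaL_perm_hom: "PGammaL_perm \<in> hom PGammaL PGammaL_perms"
proof (rule homI)
  fix x :: "('a ^ 'n ^ 'n) set \<times> ('a \<Rightarrow> 'a)" assume x: "x \<in> carrier PGammaL"
  then show "PGammaL_perm x \<in> carrier PGammaL_perms" by (simp add: PGammaL_perms_def)
  fix y :: "('a ^ 'n ^ 'n) set \<times> ('a \<Rightarrow> 'a)" assume y: "y \<in> carrier PGammaL"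
  obtain A \<sigma> where A: "x = (coset A, \<sigma>)" "invertible A" "\<sigma> \<in> field_aut" using x by (auto simp: PGammaL_carrier)
  obtain B \<tau> where B: "y = (coset B, \<tau>)" "invertible B" "\<tau> \<in> field_aut" using y by (auto simp: PGammaL_carrier)
  define T where "T v = A *v map_vec \<sigma> v" for v
  define U where "U v = B *v map_vec \<tau> v" for v
  have T: "semilinear_aut T" "PGammaL_perm x = proj_map T"
    using semilinear_matrix_aut PGammaL_perm_eq_proj_map A by (auto simp: T_def [abs_def])
  have U: "semilinear_aut U" "PGammaL_perm y = proj_map U"
    using semilinear_matrix_aut PGammaL_perm_eq_proj_map B by (auto simp: U_def [abs_def])
  have \<sigma>\<tau>: "\<sigma> \<circ> \<tau> \<in> field_aut" using A B by (auto simp: field_aut_def bij_comp)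
  have TU: "(T \<circ> U) v = (A ** map_matrix \<sigma> B) *v map_vec (\<sigma> \<circ> \<tau>) v" for v
  proof -
    have "map_vec \<sigma> (map_vec \<tau> v) = map_vec (\<sigma> \<circ> \<tau>) v" by (simp add: map_vec_def)
    then show ?thesis
      by (simp add: T_def U_def map_vec_matrix_vector_mult [OF A(3)] matrix_vector_mul_assoc)
  qed
  have "PGammaL_perm (x \<otimes>\<^bsub>PGammaL\<^esub> y) = proj_map (T \<circ> U)"
    unfolding A(1) B(1) PGammaL_mult [OF A(3)]
  proof (rule proj_points_ext)
    fix v :: "'a ^ 'n" assume v: "v \<noteq> 0"
    show "PGammaL_perm (coset (A ** map_matrix \<sigma> B), \<sigma> \<circ> \<tau>) (vec.span {v}) = proj_map (T \<circ> U) (vec.span {v})"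
      by (simp only: PGammaL_perm_apply [OF \<sigma>\<tau> v] proj_map_span [OF semilinear_aut_comp [OF T(1) U(1)] v] TU)
  qed (auto simp: PGammaL_perm_def proj_map_def)
  also have "\<dots> = PGammaL_perm x \<otimes>\<^bsub>PGammaL_perms\<^esub> PGammaL_perm y"
    using T U by (simp add: PGammaL_perms_def BijGroup_def proj_map_Bij proj_map_comp)
  finally show "PGammaL_perm (x \<otimes>\<^bsub>PGammaL\<^esub> y) = PGammaL_perm x \<otimes>\<^bsub>PGammaL_perms\<^esub> PGammaL_perm y" .
qed

lemma matrix_vector_mult_axis: "(A *v axis j 1) = column j A" for A :: "'a::field ^ 'n ^ 'm"
  by (simp add: matrix_vector_mult_def axis_def column_def vec_eq_iff if_distrib cong: if_cong)

text \<open>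
  If \<open>[A, \<sigma>]\<close> and \<open>[B, \<tau>]\<close> induce the same permutation, the points of the basis vectors give
  \<open>A e\<^sub>i = c\<^sub>i B e\<^sub>i\<close>, and the points of \<open>e\<^sub>i + r e\<^sub>j\<close> give \<open>\<sigma>(r) c\<^sub>j = c\<^sub>i \<tau>(r)\<close>. The case \<open>r = 1\<close>
  shows that all \<open>c\<^sub>i\<close> agree, and then \<open>\<sigma> = \<tau>\<close>.
\<close>

lemma PGammaL_perm_inj:
  assumes n: "CARD('n) \<ge> 2"
  shows "inj_on PGammaL_perm (carrier (PGammaL :: (('a::field ^ 'n ^ 'n) set \<times> ('a \<Rightarrow> 'a)) monoid))"
proof (rule inj_onI)
  fix x y :: "('a ^ 'n ^ 'n) set \<times> ('a \<Rightarrow> 'a)"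
  assume "x \<in> carrier PGammaL" "y \<in> carrier PGammaL" and eq: "PGammaL_perm x = PGammaL_perm y"
  then obtain A \<sigma> B \<tau> where A: "x = (coset A, \<sigma>)" "invertible A" "\<sigma> \<in> field_aut"
    and B: "y = (coset B, \<tau>)" "invertible B" "\<tau> \<in> field_aut" by (auto simp: PGammaL_carrier)
  note \<sigma> = field_autD [OF A(3)] and \<tau> = field_autD [OF B(3)]
  have proportional: "\<exists>c. c \<noteq> 0 \<and> A *v map_vec \<sigma> v = c *s (B *v map_vec \<tau> v)" if v: "v \<noteq> 0" for v
    using fun_cong [OF eq, of "vec.span {v}"] unfolding A(1) B(1)
    by (simp add: PGammaL_perm_apply A B v) (metis span_singleton_eq_iff)
  have map_axis: "map_vec \<rho> (axis i r) = axis i (\<rho> r)" if "\<rho> 0 = 0" for \<rho> i and r :: 'a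
    using that by (simp add: map_vec_def axis_def vec_eq_iff)
  let ?b = "\<lambda>i. B *v axis i 1"
  have "\<exists>c. c \<noteq> 0 \<and> A *v axis i 1 = c *s ?b i" for i
    using proportional [of "axis i 1"] by (simp add: map_axis \<sigma> \<tau> axis_eq_0_iff)
  then obtain c where c: "\<And>i. c i \<noteq> 0" "\<And>i. A *v axis i 1 = c i *s ?b i" by metis
  have Binj: "x = 0" if "B *v x = 0" for x
    using B(2) matrix_left_invertible_ker that unfolding invertible_def by blast
  have key: "\<sigma> r * c j = c i * \<tau> r" if ij: "i \<noteq> j" for i j r
  proof -
    let ?v = "axis i 1 + axis j r"
    have "?v $ i = 1" using ij by (simp add: axis_def)
    then have "?v \<noteq> 0" by (metis zero_index zero_neq_one)
    from proportional [OF this] obtain d where d: "A *v map_vec \<sigma> ?v = d *s (B *v map_vec \<tau> ?v)" by blast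
    have mv: "map_vec \<rho> ?v = axis i 1 + \<rho> r *s axis j 1" if "\<rho> \<in> field_aut" for \<rho>
      using field_autD [OF that] ij by (simp add: map_vec_def axis_def vec_eq_iff)
    have "c i *s ?b i + (\<sigma> r * c j) *s ?b j = d *s ?b i + (d * \<tau> r) *s ?b j"
      using d by (simp add: mv A B vec.add vec.scale c vector_add_ldistrib vector_smult_assoc)
    then have "B *v ((c i - d) *s axis i 1 + (\<sigma> r * c j - d * \<tau> r) *s axis j 1) = 0"
      by (simp add: vec.add vec.scale vec_algebra)
    from Binj [OF this] have e: "(c i - d) *s axis i 1 + (\<sigma> r * c j - d * \<tau> r) *s axis j 1 = (0 :: 'a ^ 'n)" .
    have "c i = d" using arg_cong [OF e, of "\<lambda>x. x $ i"] ij by (simp add: axis_def)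
    moreover have "\<sigma> r * c j = d * \<tau> r" using arg_cong [OF e, of "\<lambda>x. x $ j"] ij by (simp add: axis_def)
    ultimately show ?thesis by simp
  qed
  have c_const: "c i = c j" for i j
    using key [of i j 1] by (cases "i = j") (simp_all add: \<sigma> \<tau>)
  obtain i j :: 'n where ij: "i \<noteq> j"
  proof -
    obtain S :: "'n set" where "card S = 2" using n obtain_subset_with_card_n by blast
    then show thesis using that by (auto simp: card_2_iff)
  qed
  have "\<sigma> r = \<tau> r" for r using key [OF ij, of r] c_const [of i j] c(1) [of j] by simp
  then have st: "\<sigma> = \<tau>" by auto
  have "A = mat_scale (c i) B"
  proof -
    have "A $ k $ j = c i * B $ k $ j" for k j
      using c(2) [of j] c_const [of i j] by (simp add: matrix_vector_mult_axis column_def vec_eq_iff)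
    then show ?thesis by (simp add: mat_scale_def vec_eq_iff)
  qed
  moreover have "coset (mat_scale d B) = coset B" if d: "d \<noteq> 0" for d
  proof
    show "coset (mat_scale d B) \<subseteq> coset B"
      unfolding coset_eq using d by auto
    show "coset B \<subseteq> coset (mat_scale d B)"
    proof
      fix X assume "X \<in> coset B"
      then obtain e where "e \<noteq> 0" "X = mat_scale e B" by (auto simp: coset_eq)
      then have "e / d \<noteq> 0" "X = mat_scale (e / d) (mat_scale d B)" using d by auto
      then show "X \<in> coset (mat_scale d B)" unfolding coset_eq by blast
    qed
  qed
  ultimately show "x = y" using A(1) B(1) st c(1) by simp
qed

section \<open>Lifting a collineation to the graph\<close>

lemma SIG_verts_cases:
  assumes "x \<in> SIG_verts"
  obtains M v where "x = Inl (mat_span {M})" "M \<noteq> 0" "eigenvec M v"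
  | v where "x = Inr (vec.span {v})" "v \<noteq> 0"
  using assms by (auto simp: SIG_verts_def mat_points_def mats_with_eigenvec_def proj_points_def)

text \<open>
  A semilinear automorphism \<open>T\<close> acts on matrices by conjugation, \<open>K M = T M T\<^sup>-\<^sup>1\<close>. The two
  semilinear parts cancel, so \<open>K M\<close> is again a matrix, and \<open>T v\<close> is an eigenvector of \<open>K M\<close> iff \<open>v\<close>
  is one of \<open>M\<close>.
\<close>

lemma SIG_aut_lift:
  fixes T :: "'a::{field,finite} ^ 'n \<Rightarrow> 'a ^ 'n"
  assumes T: "semilinear_aut T"
  obtains \<phi> where "\<phi> \<in> graph_aut SIG_verts SIG_edges"
    "\<And>v. v \<noteq> 0 \<Longrightarrow> \<phi> (Inr (vec.span {v})) = Inr (vec.span {T v})"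
proof -
  obtain \<sigma> where \<sigma>: "\<sigma> \<in> field_aut" and bij: "bij T"
    and add: "\<And>u v. T (u + v) = T u + T v" and scale: "\<And>c v. T (c *s v) = \<sigma> c *s T v"
    using T unfolding semilinear_aut_def by blast
  have invT: "inv_into UNIV T (T v) = v" "T (inv_into UNIV T v) = v" for v
    using bij by (simp_all add: bij_is_inj bij_is_surj surj_f_inv_f)
  note T_eq = inj_eq [OF bij_is_inj [OF bij]]
  note T0 = semilinear_aut_nonzero_iff [OF T]
  define K where "K M = matrix (\<lambda>x. T (M *v inv_into UNIV T x))" for M :: "'a ^ 'n ^ 'n"
  have K: "K M *v T v = T (M *v v)" for M v
  proof -
    have inv_add: "inv_into UNIV T (u + v) = inv_into UNIV T u + inv_into UNIV T v" for u v
      by (rule T_eq [THEN iffD1]) (simp add: invT add)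
    have inv_scale: "inv_into UNIV T (c *s v) = inv_into UNIV \<sigma> c *s inv_into UNIV T v" for c v
      by (rule T_eq [THEN iffD1])
        (simp add: invT scale surj_f_inv_f [OF bij_is_surj [OF field_autD(1) [OF \<sigma>]]])
    have "Vector_Spaces.linear (*s) (*s) (\<lambda>x. T (M *v inv_into UNIV T x))"
      by unfold_locales
        (simp_all add: inv_add inv_scale vec.add vec.scale add scale
          surj_f_inv_f [OF bij_is_surj [OF field_autD(1) [OF \<sigma>]]])
    then show ?thesis by (simp add: K_def matrix_works invT)
  qed
  have K_eqI: "K M = N" if "\<And>v. N *v T v = T (M *v v)" for M N
    unfolding matrix_eq
  proof
    fix x show "K M *v x = N *v x" using K [of M "inv_into UNIV T x"] that [of "inv_into UNIV T x"] by (simp add: invT)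
  qed
  have K_inj: "inj K"
  proof (rule injI)
    fix M N assume "K M = K N"
    then have "M *v v = N *v v" for v using K [of M v] K [of N v] T_eq by metis
    then show "M = N" by (simp add: matrix_eq)
  qed
  have K_scale: "K (mat_scale c M) = mat_scale (\<sigma> c) (K M)" for c M
    by (rule K_eqI) (simp add: mat_scale_mult_vec K scale)
  have K_span: "K ` mat_span {M} = mat_span {K M}" for M
  proof -
    have "K ` mat_span {M} = (\<lambda>c. mat_scale c (K M)) ` range \<sigma>"
      by (auto simp: matvs.span_singleton K_scale image_image)
    then show ?thesis using bij_is_surj [OF field_autD(1) [OF \<sigma>]] by (simp add: matvs.span_singleton)
  qed
  have K0: "K M = 0 \<longleftrightarrow> M = 0" for M
  proof -
    have "K 0 = 0" by (rule K_eqI) (use T0 [of 0] in simp)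
    then show ?thesis using K_inj by (metis injD)
  qed
  have K_eigen: "eigenvec (K M) (T v) \<longleftrightarrow> eigenvec M v" for M v
  proof -
    have "T (M *v v) \<in> T ` vec.span {v} \<longleftrightarrow> M *v v \<in> vec.span {v}"
      by (simp add: inj_image_mem_iff bij_is_inj [OF bij])
    then show ?thesis by (simp add: eigenvec_iff K T0 semilinear_aut_span [OF T])
  qed
  define \<phi> :: "('a, 'n) sig_vertex \<Rightarrow> ('a, 'n) sig_vertex"
    where "\<phi> = restrict (map_sum ((`) K) ((`) T)) SIG_verts"
  have \<phi>_Inr: "\<phi> (Inr (vec.span {v})) = Inr (vec.span {T v})" if "v \<noteq> 0" for v
    using that by (simp add: \<phi>_def SIG_verts_Inr_iff span_in_proj_points semilinear_aut_span [OF T])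
  have \<phi>_Inl: "\<phi> (Inl (mat_span {M})) = Inl (mat_span {K M})" if "M \<noteq> 0" "eigenvec M v" for M v
  proof -
    have "Inl (mat_span {M}) \<in> SIG_verts"
      using that by (auto simp: SIG_verts_def mat_points_def mats_with_eigenvec_def)
    then show ?thesis by (simp add: \<phi>_def K_span)
  qed
  have inj: "inj_on \<phi> SIG_verts"
  proof (rule inj_onI)
    fix x y assume "x \<in> SIG_verts" "y \<in> SIG_verts" "\<phi> x = \<phi> y"
    then show "x = y"
      using inj_image_eq_iff [OF K_inj] inj_image_eq_iff [OF bij_is_inj [OF bij]]
      by (cases x; cases y) (auto simp: \<phi>_def)
  qed
  have into: "\<phi> x \<in> SIG_verts" if "x \<in> SIG_verts" for x
    using that
  proof (cases rule: SIG_verts_cases)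
    case (1 M v)
    then show ?thesis using \<phi>_Inl [of M v] K0 K_eigen [of M v]
      by (auto simp: SIG_verts_def mat_points_def mats_with_eigenvec_def)
  next
    case (2 v)
    then show ?thesis using \<phi>_Inr T0 span_in_proj_points by (auto simp: SIG_verts_Inr_iff)
  qed
  have "\<phi> ` SIG_verts = SIG_verts"
    by (rule endo_inj_surj) (use inj into in auto)
  then have Bij: "\<phi> \<in> Bij SIG_verts"
    using inj by (auto simp: Bij_def bij_betw_def \<phi>_def)
  have edge: "{Inl (mat_span {M}), Inr (vec.span {v})} \<in> SIG_edges \<longleftrightarrow>
      {\<phi> (Inl (mat_span {M})), \<phi> (Inr (vec.span {v}))} \<in> SIG_edges"
    if "M \<noteq> 0" "eigenvec M u" "v \<noteq> 0" for M u v
    using that by (simp add: \<phi>_Inl [OF that(1,2)] \<phi>_Inr SIG_edge_iff K0 K_eigen)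
  have "{x, y} \<in> SIG_edges \<longleftrightarrow> {\<phi> x, \<phi> y} \<in> SIG_edges" if xy: "x \<in> SIG_verts" "y \<in> SIG_verts" for x y
    using xy(1)
  proof (cases rule: SIG_verts_cases)
    case x: (1 M u)
    show ?thesis using xy(2)
    proof (cases rule: SIG_verts_cases)
      case (1 N v)
      then show ?thesis using x by (simp add: \<phi>_Inl SIG_edge_Inl)
    next
      case (2 v)
      then show ?thesis using x edge by simp
    qed
  next
    case x: (2 u)
    show ?thesis using xy(2)
    proof (cases rule: SIG_verts_cases)
      case (1 N v)
      then show ?thesis using x edge by (simp add: insert_commute)
    next
      case (2 v)
      then show ?thesis using x by (simp add: \<phi>_Inr SIG_edge_Inr)
    qed
  qed
  then have "\<phi> \<in> graph_aut SIG_verts SIG_edges" using Bij by (simp add: graph_aut_def)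
  then show thesis using that \<phi>_Inr by blast
qed

lemma restrict_points_eq_proj_map:
  assumes T: "semilinear_aut T" and \<phi>: "\<And>v. v \<noteq> 0 \<Longrightarrow> \<phi> (Inr (vec.span {v})) = Inr (vec.span {T v})"
  shows "restrict_points \<phi> = proj_map T"
  by (rule proj_points_ext)
    (use \<phi> proj_map_span [OF T] in \<open>simp_all add: restrict_points_def proj_map_def span_in_proj_points\<close>)

text \<open>
  The restrictions of graph automorphisms are the permutations induced by semilinear maps: one
  inclusion is the reconstruction of \<open>T\<close> from the graph, the other the lift by conjugation.
\<close>

lemma restrict_points_image:
  assumes n: "CARD('n) \<ge> 3"
  shows "restrict_points ` carrier (SIG_Aut :: (('a::{field,finite}, 'n::finite) sig_vertex \<Rightarrow> ('a, 'n) sig_vertex) monoid)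
    = carrier PGammaL_perms"
  unfolding PGammaL_perms_carrier
proof
  show "restrict_points ` carrier (SIG_Aut :: (('a, 'n) sig_vertex \<Rightarrow> ('a, 'n) sig_vertex) monoid)
      \<subseteq> proj_map ` {T. semilinear_aut T}"
  proof
    fix f assume "f \<in> restrict_points ` carrier (SIG_Aut :: (('a, 'n) sig_vertex \<Rightarrow> ('a, 'n) sig_vertex) monoid)"
    then obtain \<phi> :: "('a, 'n) sig_vertex \<Rightarrow> ('a, 'n) sig_vertex"
      where \<phi>: "f = restrict_points \<phi>" "\<phi> \<in> graph_aut SIG_verts SIG_edges" by (auto simp: graph_Aut_def)
    obtain T where "semilinear_aut T" "\<And>v. v \<noteq> 0 \<Longrightarrow> \<phi> (Inr (vec.span {v})) = Inr (vec.span {T v})"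
      using SIG_aut_semilinear [OF n \<phi>(2)] by blast
    then show "f \<in> proj_map ` {T. semilinear_aut T}"
      using restrict_points_eq_proj_map \<phi>(1) by blast
  qed
  show "proj_map ` {T. semilinear_aut T}
      \<subseteq> restrict_points ` carrier (SIG_Aut :: (('a, 'n) sig_vertex \<Rightarrow> ('a, 'n) sig_vertex) monoid)"
  proof
    fix f :: "('a ^ 'n) set \<Rightarrow> ('a ^ 'n) set" assume "f \<in> proj_map ` {T. semilinear_aut T}"
    then obtain T where T: "semilinear_aut T" "f = proj_map T" by blast
    obtain \<phi> where "\<phi> \<in> graph_aut SIG_verts SIG_edges"
      "\<And>v. v \<noteq> 0 \<Longrightarrow> \<phi> (Inr (vec.span {v})) = Inr (vec.span {T v})"
      using SIG_aut_lift [OF T(1)] by blast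
    then show "f \<in> restrict_points ` carrier (SIG_Aut :: (('a, 'n) sig_vertex \<Rightarrow> ('a, 'n) sig_vertex) monoid)"
      using restrict_points_eq_proj_map [OF T(1)] T(2) by (intro image_eqI [of _ _ \<phi>]) (simp_all add: graph_Aut_def)
  qed
qed

lemma restrict_points_hom:
  assumes n: "CARD('n) \<ge> 3"
  shows "restrict_points \<in> hom (SIG_Aut :: (('a::{field,finite}, 'n::finite) sig_vertex \<Rightarrow> ('a, 'n) sig_vertex) monoid)
    (BijGroup proj_points)"
proof (rule homI)
  fix \<phi> :: "('a, 'n) sig_vertex \<Rightarrow> ('a, 'n) sig_vertex" assume \<phi>: "\<phi> \<in> carrier SIG_Aut"
  then obtain T where T: "semilinear_aut T" "\<And>v. v \<noteq> 0 \<Longrightarrow> \<phi> (Inr (vec.span {v})) = Inr (vec.span {T v})"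
    using SIG_aut_semilinear [OF n, of \<phi>] by (auto simp: graph_Aut_def)
  note rT = restrict_points_eq_proj_map [OF T]
  then show "restrict_points \<phi> \<in> carrier (BijGroup proj_points)"
    using proj_map_Bij [OF T(1)] by (simp add: BijGroup_def)
  fix \<psi> :: "('a, 'n) sig_vertex \<Rightarrow> ('a, 'n) sig_vertex" assume \<psi>: "\<psi> \<in> carrier SIG_Aut"
  then obtain U where U: "semilinear_aut U" "\<And>v. v \<noteq> 0 \<Longrightarrow> \<psi> (Inr (vec.span {v})) = Inr (vec.span {U v})"
    using SIG_aut_semilinear [OF n, of \<psi>] by (auto simp: graph_Aut_def)
  note rU = restrict_points_eq_proj_map [OF U]
  have "(\<phi> \<otimes>\<^bsub>SIG_Aut\<^esub> \<psi>) (Inr (vec.span {v})) = Inr (vec.span {(T \<circ> U) v})" if v: "v \<noteq> 0" for v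
    using \<phi> \<psi> v T(2) [of "U v"] U(2) [OF v] semilinear_aut_nonzero_iff [OF U(1), of v] span_in_proj_points [OF v]
    by (simp add: graph_Aut_def BijGroup_def graph_aut_def compose_def SIG_verts_Inr_iff)
  from restrict_points_eq_proj_map [OF semilinear_aut_comp [OF T(1) U(1)] this]
  show "restrict_points (\<phi> \<otimes>\<^bsub>SIG_Aut\<^esub> \<psi>) =
      restrict_points \<phi> \<otimes>\<^bsub>BijGroup proj_points\<^esub> restrict_points \<psi>"
    by (simp add: rT rU BijGroup_def proj_map_Bij T U proj_map_comp comp_def)
qed

theorem lemma3p12:
  assumes "CARD('n::finite) \<ge> 3"
  shows
    "(\<forall>\<phi> \<in> carrier (SIG_Aut :: (('a::{field,finite}, 'n) sig_vertex \<Rightarrow> ('a, 'n) sig_vertex) monoid).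
        (\<exists>T. semilinear_aut T \<and>
             (\<forall>v. v \<noteq> 0 \<longrightarrow> \<phi> (Inr (vec.span {v})) = Inr (vec.span {T v}))) \<and>
        (\<exists>A. invertible A \<and> (\<exists>\<sigma>\<in>field_aut.
             (\<forall>v. v \<noteq> 0 \<longrightarrow> \<phi> (Inr (vec.span {v})) = Inr (vec.span {A *v map_vec \<sigma> v})))) \<and>
        restrict_points \<phi> \<in> carrier PGammaL_perms) \<and>
     PGammaL_perm \<in> iso (PGammaL :: (('a ^ 'n ^ 'n) set \<times> ('a \<Rightarrow> 'a)) monoid) PGammaL_perms \<and>
     group_hom (SIG_Aut :: (('a, 'n) sig_vertex \<Rightarrow> ('a, 'n) sig_vertex) monoid)
       PGammaL_perms restrict_points \<and>
     restrict_points \<in> epi (SIG_Aut :: (('a, 'n) sig_vertex \<Rightarrow> ('a, 'n) sig_vertex) monoid)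
       PGammaL_perms"
proof (intro conjI ballI)
  let ?G = "SIG_Aut :: (('a, 'n) sig_vertex \<Rightarrow> ('a, 'n) sig_vertex) monoid"
  let ?P = "PGammaL_perms :: (('a ^ 'n) set \<Rightarrow> ('a ^ 'n) set) monoid"
  note image = restrict_points_image [OF assms, where ?'a = 'a]
  fix \<phi> assume \<phi>: "\<phi> \<in> carrier ?G"
  then obtain T where T: "semilinear_aut T" "\<And>v. v \<noteq> 0 \<Longrightarrow> \<phi> (Inr (vec.span {v})) = Inr (vec.span {T v})"
    using SIG_aut_semilinear [OF assms, of \<phi>] by (auto simp: graph_Aut_def)
  then show "\<exists>T. semilinear_aut T \<and> (\<forall>v. v \<noteq> 0 \<longrightarrow> \<phi> (Inr (vec.span {v})) = Inr (vec.span {T v}))" by blast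
  obtain A \<sigma> where "invertible A" "\<sigma> \<in> field_aut" "T = (\<lambda>v. A *v map_vec \<sigma> v)"
    using semilinear_aut_matrix [OF T(1)] by blast
  then show "\<exists>A. invertible A \<and> (\<exists>\<sigma>\<in>field_aut.
      (\<forall>v. v \<noteq> 0 \<longrightarrow> \<phi> (Inr (vec.span {v})) = Inr (vec.span {A *v map_vec \<sigma> v})))"
    using T(2) by blast
  show "restrict_points \<phi> \<in> carrier ?P" using image \<phi> by blast
next
  let ?G = "SIG_Aut :: (('a, 'n) sig_vertex \<Rightarrow> ('a, 'n) sig_vertex) monoid"
  let ?P = "PGammaL_perms :: (('a ^ 'n) set \<Rightarrow> ('a ^ 'n) set) monoid"
  note image = restrict_points_image [OF assms, where ?'a = 'a]
  note to_Bij = restrict_points_hom [OF assms, where ?'a = 'a]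
  have "inj_on PGammaL_perm (carrier (PGammaL :: (('a ^ 'n ^ 'n) set \<times> ('a \<Rightarrow> 'a)) monoid))"
    by (rule PGammaL_perm_inj) (use assms in simp)
  then show "PGammaL_perm \<in> iso (PGammaL :: (('a ^ 'n ^ 'n) set \<times> ('a \<Rightarrow> 'a)) monoid) ?P"
    using PGammaL_perm_hom by (auto simp: iso_def bij_betw_def PGammaL_perms_def)
  interpret h: group_hom ?G "BijGroup proj_points" restrict_points
    by (intro group_hom.intro group_hom_axioms.intro graph_aut_group group_BijGroup to_Bij)
  \<comment> \<open>The induced permutations form a group because they are the image of a homomorphism.\<close>
  have "group ?P"
    using group.subgroup_imp_group [OF group_BijGroup h.img_is_subgroup] by (simp add: image PGammaL_perms_def)
  moreover have hom: "restrict_points \<in> hom ?G ?P"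
    using to_Bij image by (auto simp: hom_def PGammaL_perms_def)
  ultimately show "group_hom ?G ?P restrict_points"
    by (intro group_hom.intro group_hom_axioms.intro graph_aut_group)
  show "restrict_points \<in> epi ?G ?P" using hom image by (simp add: epi_def)
qed

end
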